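(* For every graph $G$ we have $t_\ell(G)\leq\mathrm{stw}(G)$.
   Context: All graphs are finite and simple. A simple $k$-tree is a graph obtainable by starting with a $(k+1)$-clique and repeatedly adding a new vertex adjacent exactly to the vertices of some $k$-clique of the current graph, such that no two vertices are added onto the same $k$-clique. The simple tree-width $\mathrm{stw}(G)$ is the minimum $k$ such that $G$ is a subgraph of some simple $k$-tree. An interval graph is the intersection graph of a finite family of intervals of the real line. The local track-number $t_\ell(G)$ is the minimum, over all families of interval graphs $I_1,\dots,I_k$ that are subgraphs of $G$ and whose edge sets together cover $E(G)$ ($k$ arbitrary), of the maximum over vertices $v$ of $G$ of the number of indices $i$ with $v\in V(I_i)$. *)

theory Defs
  imports "HOL-Analysis.Analysis" "HOL-Library.Ramsey"
begin

record 'a graph =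
  verts :: "'a set"
  edges :: "'a set set"

definition simple_graph :: "'a graph \<Rightarrow> bool" where
  "simple_graph G \<longleftrightarrow> finite (verts G) \<and> edges G \<subseteq> nsets (verts G) 2"

definition subgraph :: "'a graph \<Rightarrow> 'a graph \<Rightarrow> bool" where
  "subgraph H G \<longleftrightarrow> verts H \<subseteq> verts G \<and> edges H \<subseteq> edges G"

definition map_graph :: "('a \<Rightarrow> 'b) \<Rightarrow> 'a graph \<Rightarrow> 'b graph" where
  "map_graph f G = \<lparr>verts = f ` verts G, edges = (\<lambda>e. f ` e) ` edges G\<rparr>"


subsection \<open>Simple tree-width\<close>

text \<open>
  \<open>simple_ktree_constr k G U\<close>: the graph \<open>G\<close> arises by a construction sequence in which \<open>U\<close> is
  the set of \<open>k\<close>-cliques onto which a vertex has already been added.  Subsets of the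
  initial \<open>(k+1)\<close>-clique count as not yet used.
\<close>

inductive simple_ktree_constr :: "nat \<Rightarrow> 'a graph \<Rightarrow> 'a set set \<Rightarrow> bool" for k where
  init: "card K = k + 1 \<Longrightarrow> simple_ktree_constr k \<lparr>verts = K, edges = nsets K 2\<rparr> {}"
| add: "simple_ktree_constr k G U \<Longrightarrow> v \<notin> verts G \<Longrightarrow>
    C \<subseteq> verts G \<Longrightarrow> card C = k \<Longrightarrow> clique C (edges G) \<Longrightarrow> C \<notin> U \<Longrightarrow>
    simple_ktree_constr k
      \<lparr>verts = insert v (verts G), edges = edges G \<union> {{v, c} |c. c \<in> C}\<rparr> (insert C U)"

definition simple_ktree :: "nat \<Rightarrow> 'a graph \<Rightarrow> bool" where
  "simple_ktree k G \<longleftrightarrow> (\<exists>U. simple_ktree_constr k G U)"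

text \<open>
  The host may need vertices outside \<open>G\<close>, and \<open>'a\<close> may be finite, so the host lives on \<open>nat\<close>
  and contains \<open>G\<close> up to renaming of vertices.
\<close>

definition partial_simple_ktree :: "nat \<Rightarrow> 'a graph \<Rightarrow> bool" where
  "partial_simple_ktree k G \<longleftrightarrow>
    (\<exists>(H :: nat graph) f. simple_ktree k H \<and> inj_on f (verts G) \<and> subgraph (map_graph f G) H)"

definition simple_tree_width :: "'a graph \<Rightarrow> nat" where
  "simple_tree_width G = (LEAST k. partial_simple_ktree k G)"


subsection \<open>Local track-number\<close>

definition interval_graph :: "'a graph \<Rightarrow> bool" where
  "interval_graph G \<longleftrightarrow> simple_graph G \<and>
    (\<exists>J :: 'a \<Rightarrow> real set.
      (\<forall>v\<in>verts G. is_interval (J v) \<and> J v \<noteq> {}) \<and>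
      (\<forall>u\<in>verts G. \<forall>v\<in>verts G. u \<noteq> v \<longrightarrow> ({u, v} \<in> edges G \<longleftrightarrow> J u \<inter> J v \<noteq> {})))"

definition interval_cover :: "'a graph \<Rightarrow> 'a graph list \<Rightarrow> bool" where
  "interval_cover G Is \<longleftrightarrow>
    (\<forall>I\<in>set Is. interval_graph I \<and> subgraph I G) \<and> (\<Union>I\<in>set Is. edges I) = edges G"

text \<open>The inserted \<open>0\<close> only matters for the graph without vertices.\<close>

definition max_local_multiplicity :: "'a graph \<Rightarrow> 'a graph list \<Rightarrow> nat" where
  "max_local_multiplicity G Is =
    Max (insert 0 ((\<lambda>v. card {i. i < length Is \<and> v \<in> verts (Is ! i)}) ` verts G))"

definition local_track_number :: "'a graph \<Rightarrow> nat" where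
  "local_track_number G = (LEAST m. \<exists>Is. interval_cover G Is \<and> max_local_multiplicity G Is = m)"


subsection \<open>Both minima range over nonempty sets\<close>

lemma ex_partial_simple_ktree:
  assumes "simple_graph G"
  shows "\<exists>k. partial_simple_ktree k G"
proof -
  have fin: "finite (verts G)" and E: "edges G \<subseteq> nsets (verts G) 2"
    using assms by (auto simp: simple_graph_def)
  obtain f :: "'a \<Rightarrow> nat" where f: "inj_on f (verts G)"
    using fin finite_imp_inj_to_nat_seg by metis
  define K where "K = insert 0 (f ` verts G)"
  have "card K = (card K - 1) + 1"
    using fin by (simp add: K_def card_gt_0_iff Suc_leI)
  then have "simple_ktree (card K - 1) \<lparr>verts = K, edges = nsets K 2\<rparr>"
    unfolding simple_ktree_def by (blast intro: simple_ktree_constr.init)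
  moreover have "f ` e \<in> nsets K 2" if "e \<in> edges G" for e
  proof -
    have "e \<subseteq> verts G" "finite e" "card e = 2"
      using that E by (auto simp: nsets_def)
    then show ?thesis
      using card_image[OF inj_on_subset[OF f, of e]] by (auto simp: nsets_def K_def)
  qed
  then have "subgraph (map_graph f G) \<lparr>verts = K, edges = nsets K 2\<rparr>"
    by (auto simp: subgraph_def map_graph_def K_def)
  ultimately show ?thesis
    unfolding partial_simple_ktree_def using f by blast
qed

lemma ex_interval_cover:
  assumes "simple_graph G"
  shows "\<exists>Is. interval_cover G Is"
proof -
  have fin: "finite (verts G)" and E: "edges G \<subseteq> nsets (verts G) 2"
    using assms by (auto simp: simple_graph_def)
  have "edges G \<subseteq> Pow (verts G)"
    using E by (auto simp: nsets_def)
  then have "finite (edges G)"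
    using fin by (simp add: finite_subset)
  then obtain es where es: "set es = edges G"
    using finite_list by blast
  define I where "I = (\<lambda>e::'a set. \<lparr>verts = e, edges = {e}\<rparr>)"
  have "interval_graph (I e) \<and> subgraph (I e) G" if "e \<in> edges G" for e
  proof -
    have e: "e \<in> nsets (verts G) 2"
      using that E by blast
    then have "simple_graph (I e)" and "subgraph (I e) G"
      using that by (auto simp: simple_graph_def subgraph_def I_def nsets_def)
    moreover have "{u, v} = e" if "u \<in> e" "v \<in> e" "u \<noteq> v" for u v
      using e that by (intro card_subset_eq) (auto simp: nsets_def)
    then have "\<exists>J :: 'a \<Rightarrow> real set.
      (\<forall>v\<in>e. is_interval (J v) \<and> J v \<noteq> {}) \<and>
      (\<forall>u\<in>e. \<forall>v\<in>e. u \<noteq> v \<longrightarrow> ({u, v} \<in> {e} \<longleftrightarrow> J u \<inter> J v \<noteq> {}))"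
      by (intro exI[of _ "\<lambda>_. {0}"]) (auto simp: is_interval_1)
    ultimately show ?thesis
      by (simp add: interval_graph_def I_def)
  qed
  then have "interval_cover G (map I es)"
    by (auto simp: interval_cover_def es I_def)
  then show ?thesis ..
qed

end

(*
  A construction sequence of a simple k-tree containing G is followed step by step while a cover of
  G is maintained.  For k >= 3 every vertex w owns one track, in which w is adjacent to all vertices
  of a star forest; a cone over an interval graph is an interval graph.  A vertex lies in its own
  track and should join at most k - 1 others.  A new vertex with all k edges to its clique C present
  in G may thus join the tracks of only k - 1 vertices of C.  Either C contains vertices y and w such that y is a centre in the track of w:
  then the new vertex joins the tracks of C - {y}, and its edge to y is added to the track of w.  Or
  some y in C still has room for one more track and joins that of the new vertex.  Since every
  clique is used at most once, this room can be reserved for it in advance.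
  For k = 2 the graph is cut into paths, and each path together with the vertices attached to it
  forms a caterpillar-like interval graph; every vertex lies on one path and is attached to at most
  one other.  For k = 1 the graph is a linear forest, and for k = 0 it has no edges.
*)

theory Submission
  imports Defs
begin

text \<open>If every vertex joined the cones of all k vertices of its clique, it would lie in k + 1
  tracks; the effort goes into saving one. Saving is an issue only when all k edges to the clique
  lie in \<open>G\<close>. With an edge missing there is room anyway, and the room left over pays
  for reservations on the new cliques. A clique with a centre and its apex can serve any number of
  new leaves, but a reserved place can be spent only once. Hence the construction is recast with a
  finite set \<open>A\<close> of cliques that are still available, over which reservations can be
  counted. The k new cliques of a step each omit one vertex c of the old clique C. To make such a
  clique good again, the new vertex should be a centre in the cone of some vertex of C other than c
  and other than one exceptional vertex. Such a vertex exists for k >= 3, which is why smaller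
  widths need structures of their own.\<close>

section \<open>From covers of the renamed copy to the local track-number\<close>

lemma interval_graphE:
  assumes "interval_graph I"
  obtains J where "finite (verts I)" "edges I \<subseteq> nsets (verts I) 2"
    "\<And>v. v \<in> verts I \<Longrightarrow> is_interval (J v :: real set) \<and> J v \<noteq> {}"
    "\<And>u v. u \<in> verts I \<Longrightarrow> v \<in> verts I \<Longrightarrow> u \<noteq> v \<Longrightarrow> {u, v} \<in> edges I \<longleftrightarrow> J u \<inter> J v \<noteq> {}"
  using assms unfolding interval_graph_def simple_graph_def
  by (elim conjE exE) (rule that; simp)

text \<open>Tracks are built on the renamed copy of \<open>G\<close> inside the host and pulled back
  along \<open>f\<close>. Since each \<open>I w\<close> is a subgraph of the copy and
  \<open>f\<close> is injective, the pulled back graph is isomorphic to \<open>I w\<close> and is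
  represented by the intervals \<open>J (f v)\<close>.\<close>

lemma local_track_number_le:
  fixes G :: "'a graph" and f :: "'a \<Rightarrow> 'b" and I :: "'c \<Rightarrow> 'b graph"
  assumes G: "simple_graph G" and f: "inj_on f (verts G)" and W: "finite W"
    and int: "\<And>w. w \<in> W \<Longrightarrow> interval_graph (I w)"
    and sub: "\<And>w. w \<in> W \<Longrightarrow> subgraph (I w) (map_graph f G)"
    and cov: "edges (map_graph f G) \<subseteq> (\<Union>w\<in>W. edges (I w))"
    and mult: "\<And>v. v \<in> f ` verts G \<Longrightarrow> card {w\<in>W. v \<in> verts (I w)} \<le> k"
  shows "local_track_number G \<le> k"
proof -
  \<comment> \<open>Distinctness lets list positions, which the multiplicity counts, stand for
    elements of \<open>W\<close>.\<close>
  obtain ws where ws: "set ws = W" "distinct ws"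
    using W finite_distinct_list by blast
  define I' where "I' w = \<lparr>verts = {v\<in>verts G. f v \<in> verts (I w)},
    edges = {e\<in>edges G. f ` e \<in> edges (I w)}\<rparr>" for w
  have EG: "edges G \<subseteq> nsets (verts G) 2" and fG: "finite (verts G)"
    using G by (auto simp: simple_graph_def)
  have int': "interval_graph (I' w)" if w: "w \<in> W" for w
  proof -
    obtain J :: "'b \<Rightarrow> real set" where
      EI: "edges (I w) \<subseteq> nsets (verts (I w)) 2" and
      J1: "\<And>v. v \<in> verts (I w) \<Longrightarrow> is_interval (J v) \<and> J v \<noteq> {}" and
      J2: "\<And>u v. u \<in> verts (I w) \<Longrightarrow> v \<in> verts (I w) \<Longrightarrow> u \<noteq> v \<Longrightarrow>
        {u, v} \<in> edges (I w) \<longleftrightarrow> J u \<inter> J v \<noteq> {}"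
      using int[OF w] by (rule interval_graphE) blast
    have "e \<in> nsets (verts (I' w)) 2" if e: "e \<in> edges (I' w)" for e
    proof -
      have "e \<in> nsets (verts G) 2" "f ` e \<in> nsets (verts (I w)) 2"
        using e EG EI by (auto simp: I'_def)
      then show ?thesis by (auto simp: I'_def nsets_def)
    qed
    then have "simple_graph (I' w)"
      using fG by (auto simp: simple_graph_def I'_def)
    moreover have "{u, v} \<in> edges (I' w) \<longleftrightarrow> J (f u) \<inter> J (f v) \<noteq> {}"
      if u: "u \<in> verts (I' w)" and v: "v \<in> verts (I' w)" and uv: "u \<noteq> v" for u v
    proof -
      have uG: "u \<in> verts G" "v \<in> verts G" "f u \<in> verts (I w)" "f v \<in> verts (I w)"
        using u v by (auto simp: I'_def)
      have "f u \<noteq> f v" using uG uv f by (meson inj_onD)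
      then have *: "{f u, f v} \<in> edges (I w) \<longleftrightarrow> J (f u) \<inter> J (f v) \<noteq> {}"
        using J2 uG by blast
      have "{u, v} \<in> edges G" if "{f u, f v} \<in> edges (I w)"
      proof -
        have "{f u, f v} \<in> (\<lambda>e. f ` e) ` edges G"
          using that sub[OF w] by (auto simp: subgraph_def map_graph_def)
        then obtain e where e: "e \<in> edges G" "{f u, f v} = f ` e" by blast
        have "e \<subseteq> verts G" using e EG by (auto simp: nsets_def)
        moreover have "f ` e = f ` {u, v}" using e by simp
        ultimately have "e = {u, v}"
          using inj_on_image_eq_iff[OF f, of e "{u, v}"] uG by auto
        then show ?thesis using e by simp
      qed
      then show ?thesis using * by (auto simp: I'_def)
    qed
    ultimately show ?thesis
      unfolding interval_graph_def using J1 by (intro conjI exI[of _ "J \<circ> f"]) (auto simp: I'_def)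
  qed
  have "subgraph (I' w) G" for w
    by (auto simp: subgraph_def I'_def)
  moreover have "(\<Union>w\<in>W. edges (I' w)) = edges G"
  proof (intro equalityI subsetI)
    fix e assume e: "e \<in> edges G"
    then have "f ` e \<in> edges (map_graph f G)" by (simp add: map_graph_def)
    then obtain w where "w \<in> W" "f ` e \<in> edges (I w)" using cov by blast
    then show "e \<in> (\<Union>w\<in>W. edges (I' w))" using e by (auto simp: I'_def)
  qed (auto simp: I'_def)
  ultimately have cover: "interval_cover G (map I' ws)"
    unfolding interval_cover_def using int' ws by auto
  have "card {i. i < length (map I' ws) \<and> v \<in> verts (map I' ws ! i)} \<le> k" if v: "v \<in> verts G" for v
  proof -
    have "card {i. i < length ws \<and> v \<in> verts (I' (ws ! i))} \<le> card {w\<in>W. f v \<in> verts (I w)}"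
      using W ws by (intro card_inj_on_le[where f="\<lambda>i. ws ! i"])
        (auto simp: inj_on_def nth_eq_iff_index_eq I'_def)
    moreover have "{i. i < length (map I' ws) \<and> v \<in> verts (map I' ws ! i)}
      = {i. i < length ws \<and> v \<in> verts (I' (ws ! i))}" by auto
    ultimately show ?thesis using mult[of "f v"] v by simp
  qed
  then have "max_local_multiplicity G (map I' ws) \<le> k"
    unfolding max_local_multiplicity_def using fG by (subst Max_le_iff) auto
  moreover have "local_track_number G \<le> max_local_multiplicity G (map I' ws)"
    unfolding local_track_number_def using cover by (intro Least_le) blast
  ultimately show ?thesis by simp
qed

subsection \<open>Cliques available in the construction of a simple k-tree\<close>

text \<open>
  The tag makes two copies of the base clique available, so that the initial \<open>(k+1)\<close>-clique is
  itself the result of a step.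
\<close>

inductive clique_build :: "nat \<Rightarrow> 'a set \<Rightarrow> 'a set set \<Rightarrow> ('a set \<times> bool) set \<Rightarrow> bool" for k where
  base: "finite B \<Longrightarrow> card B = k \<Longrightarrow> clique_build k B (nsets B 2) {(B, False), (B, True)}"
| step: "clique_build k V H A \<Longrightarrow> (C, t) \<in> A \<Longrightarrow> v \<notin> V \<Longrightarrow>
    clique_build k (insert v V) (H \<union> {{v, c} |c. c \<in> C})
      (A - {(C, t)} \<union> (\<lambda>c. (insert v (C - {c}), False)) ` C)"

lemma clique_build_wf:
  assumes "clique_build k V H A"
  shows "finite V" "finite A" "H \<subseteq> nsets V 2" "\<And>C t. (C, t) \<in> A \<Longrightarrow> C \<subseteq> V \<and> card C = k \<and> finite C"
proof -
  have "finite V \<and> finite A \<and> H \<subseteq> nsets V 2 \<and> (\<forall>C t. (C, t) \<in> A \<longrightarrow> C \<subseteq> V \<and> card C = k)"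
    using assms
  proof (induction rule: clique_build.induct)
    case (base B)
    then show ?case by auto
  next
    case (step V H A C t v)
    then have H: "finite V" "finite A" "H \<subseteq> nsets V 2" "\<forall>C t. (C, t) \<in> A \<longrightarrow> C \<subseteq> V \<and> card C = k"
      by auto
    then have C: "C \<subseteq> V" "card C = k" using step.hyps(2) by auto
    then have fC: "finite C" using H finite_subset by blast
    have new: "insert v (C - {c}) \<subseteq> insert v V \<and> card (insert v (C - {c})) = k" if "c \<in> C" for c
    proof -
      have "v \<notin> C - {c}" using C step.hyps(3) by auto
      moreover have "card C > 0" using that fC by (auto simp: card_gt_0_iff)
      ultimately show ?thesis using C fC that by auto
    qed
    have "H \<union> {{v, c} |c. c \<in> C} \<subseteq> nsets (insert v V) 2"
    proof -
      have "nsets V 2 \<subseteq> nsets (insert v V) 2" by (auto simp: nsets_def)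
      moreover have "{{v, c} |c. c \<in> C} \<subseteq> nsets (insert v V) 2"
        using C(1) step.hyps(3) by auto
      ultimately show ?thesis using H(3) by (meson Un_least subset_trans)
    qed
    moreover have "D \<subseteq> insert v V \<and> card D = k"
      if D: "(D, s) \<in> A - {(C, t)} \<union> (\<lambda>c. (insert v (C - {c}), False)) ` C" for D s
    proof (cases "(D, s) \<in> A")
      case True
      then show ?thesis using H(4) by auto
    next
      case False
      then obtain c where "c \<in> C" "D = insert v (C - {c})" using D by auto
      then show ?thesis using new by simp
    qed
    moreover have "finite (insert v V)" "finite (A - {(C, t)} \<union> (\<lambda>c. (insert v (C - {c}), False)) ` C)"
      using H(1,2) fC by auto
    ultimately show ?case by simp
  qed
  then show "finite V" "finite A" "H \<subseteq> nsets V 2" "\<And>C t. (C, t) \<in> A \<Longrightarrow> C \<subseteq> V \<and> card C = k \<and> finite C"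
    by (simp_all, meson finite_subset)
qed

text \<open>The neighbours of a new vertex v are exactly the vertices of C. So a k-clique through v
  arises from C by exchanging one vertex for v, and these are the cliques that \<open>step\<close>
  adds; a clique avoiding v was a clique before.\<close>

lemma simple_ktree_clique_build_aux:
  assumes "simple_ktree_constr k G U"
  shows "\<exists>A. clique_build k (verts G) (edges G) A \<and>
    (\<forall>C. C \<subseteq> verts G \<longrightarrow> card C = k \<longrightarrow> clique C (edges G) \<longrightarrow> C \<notin> U \<longrightarrow> (\<exists>t. (C, t) \<in> A))"
  using assms
proof (induction rule: simple_ktree_constr.induct)
  case (init K)
  then have fK: "finite K" using card.infinite by fastforce
  obtain v where v: "v \<in> K" using init by fastforce
  define B where "B = K - {v}"
  have B: "finite B" "card B = k" "v \<notin> B" "K = insert v B" using v init fK by (auto simp: B_def)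
  \<comment> \<open>The step that completes the initial clique consumes the copy
    \<open>(B, True)\<close>; the copy \<open>(B, False)\<close> keeps \<open>B\<close> itself
    available.\<close>
  define A where "A = {(B, False), (B, True)} - {(B, True)} \<union> (\<lambda>c. (insert v (B - {c}), False)) ` B"
  have "clique_build k (insert v B) (nsets B 2 \<union> {{v, c} |c. c \<in> B}) A"
    unfolding A_def by (rule clique_build.step[OF clique_build.base]) (use B in auto)
  moreover have "nsets B 2 \<union> {{v, c} |c. c \<in> B} = nsets K 2"
  proof (intro equalityI subsetI)
    fix e assume "e \<in> nsets K 2"
    then obtain a b where "e = {a, b}" "a \<in> K" "b \<in> K" "a \<noteq> b"
      by (rule nsets2_E)
    then show "e \<in> nsets B 2 \<union> {{v, c} |c. c \<in> B}" using B by auto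
  next
    fix e assume "e \<in> nsets B 2 \<union> {{v, c} |c. c \<in> B}"
    then show "e \<in> nsets K 2" using B by (auto simp: nsets_def card_insert_if)
  qed
  moreover have "\<exists>t. (C, t) \<in> A" if C: "C \<subseteq> K" "card C = k" for C
  proof -
    have "card (K - C) = 1" using C init fK by (simp add: card_Diff_subset finite_subset)
    then obtain c where c: "K - C = {c}" by (auto simp: card_1_singleton_iff)
    then have Ceq: "C = K - {c}" "c \<in> K" using C by auto
    show ?thesis
    proof (cases "c = v")
      case True
      then show ?thesis using Ceq by (auto simp: A_def B_def)
    next
      case False
      then have "C = insert v (B - {c})" "c \<in> B" using Ceq B by auto
      then show ?thesis by (auto simp: A_def)
    qed
  qed
  ultimately show ?case using B by auto
next
  case (add G U v C)
  then obtain A where A: "clique_build k (verts G) (edges G) A"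
    and avail: "\<And>C. C \<subseteq> verts G \<Longrightarrow> card C = k \<Longrightarrow> clique C (edges G) \<Longrightarrow> C \<notin> U \<Longrightarrow> \<exists>t. (C, t) \<in> A"
    by blast
  obtain t where t: "(C, t) \<in> A" using avail add by blast
  have wf: "finite (verts G)" "edges G \<subseteq> nsets (verts G) 2" using clique_build_wf[OF A] by auto
  have fC: "finite C" using clique_build_wf(4)[OF A t] by simp
  define A' where "A' = A - {(C, t)} \<union> (\<lambda>c. (insert v (C - {c}), False)) ` C"
  have "clique_build k (insert v (verts G)) (edges G \<union> {{v, c} |c. c \<in> C}) A'"
    unfolding A'_def by (rule clique_build.step[OF A t]) (use add in auto)
  moreover have "\<exists>t. (C', t) \<in> A'"
    if C': "C' \<subseteq> insert v (verts G)" "card C' = k" "clique C' (edges G \<union> {{v, c} |c. c \<in> C})"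
      "C' \<notin> insert C U" for C'
  proof (cases "v \<in> C'")
    case False
    have "clique C' (edges G)"
      using C'(3) False by (auto simp: clique_def doubleton_eq_iff)
    then obtain t' where "(C', t') \<in> A" using avail C' False by blast
    then show ?thesis using C' by (auto simp: A'_def)
  next
    case True
    have fC': "finite C'" using C' wf by (meson finite_insert finite_subset)
    have "C' - {v} \<subseteq> C"
    proof
      fix x assume x: "x \<in> C' - {v}"
      then have "{v, x} \<in> edges G \<union> {{v, c} |c. c \<in> C}" using C'(3) True by (auto simp: clique_def)
      moreover have "{v, x} \<notin> edges G" using wf add by auto
      ultimately show "x \<in> C" using x by (auto simp: doubleton_eq_iff)
    qed
    moreover have "card (C - (C' - {v})) = 1"
    proof -
      have "card C' > 0" using True fC' by (auto simp: card_gt_0_iff)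
      then show ?thesis
        using calculation True fC' fC C' add.hyps by (simp add: card_Diff_subset)
    qed
    then obtain c where "C - (C' - {v}) = {c}" by (auto simp: card_1_singleton_iff)
    ultimately have "C' = insert v (C - {c})" "c \<in> C" using True by auto
    then show ?thesis by (auto simp: A'_def)
  qed
  ultimately show ?case by auto
qed

lemma simple_ktree_clique_build:
  assumes "simple_ktree k H"
  obtains A where "clique_build k (verts H) (edges H) A"
proof -
  obtain U where "simple_ktree_constr k H U"
    using assms unfolding simple_ktree_def ..
  from simple_ktree_clique_build_aux[OF this] show thesis
    using that by (elim exE conjE)
qed

subsection \<open>Caterpillars and cones are interval graphs\<close>

text \<open>A spine vertex takes an interval starting at its position. Leaves with one neighbour are
  points in the open first half of the unit after it; the second half is kept for the leaf over two
  consecutive spine vertices, of which \<open>uniq\<close> allows only one. The spine edge below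
  that leaf may be absent: the leaf then bridges the gap between two disjoint spine
  intervals.\<close>

lemma interval_graph_caterpillar:
  fixes I :: "nat graph" and pos :: "nat \<Rightarrow> int"
  assumes I: "simple_graph I" and PL: "verts I = P \<union> L" "P \<inter> L = {}" and inj: "inj_on pos P"
    and spine: "\<And>a b. a \<in> P \<Longrightarrow> b \<in> P \<Longrightarrow> {a, b} \<in> edges I \<Longrightarrow> \<bar>pos a - pos b\<bar> = 1"
    and nbrs: "\<And>u. u \<in> L \<Longrightarrow> \<exists>a\<in>P. {x. {x, u} \<in> edges I} = {a} \<or>
      (\<exists>b\<in>P. {x. {x, u} \<in> edges I} = {a, b} \<and> pos b = pos a + 1)"
    and uniq: "\<And>u u' a b. u \<in> L \<Longrightarrow> u' \<in> L \<Longrightarrow> {x. {x, u} \<in> edges I} = {a, b} \<Longrightarrow>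
      {x. {x, u'} \<in> edges I} = {a, b} \<Longrightarrow> a \<noteq> b \<Longrightarrow> u = u'"
  shows "interval_graph I"
proof -
  define N where "N u = {x. {x, u} \<in> edges I}" for u
  obtain q where q: "\<And>u. u \<in> L \<Longrightarrow> q u \<in> P \<and> (N u = {q u} \<or> (\<exists>b\<in>P. N u = {q u, b} \<and> pos b = pos (q u) + 1))"
  proof -
    have "\<forall>u\<in>L. \<exists>a. a \<in> P \<and> (N u = {a} \<or> (\<exists>b\<in>P. N u = {a, b} \<and> pos b = pos a + 1))"
      using nbrs unfolding N_def by blast
    then show thesis using that by (auto dest!: bchoice)
  qed
  define sg where "sg u \<longleftrightarrow> N u = {q u}" for u
  \<comment> \<open>The offsets \<open>1 / (real u + 3)\<close> are positive, below
    \<open>1 / 2\<close> already for \<open>u = 0\<close>, and distinct for distinct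
    \<open>u\<close>. So a leaf with one neighbour meets neither the preceding spine interval nor
    any other leaf.\<close>
  define l where "l u = (if u \<in> P then real_of_int (pos u)
     else if sg u then pos (q u) + 1 / (real u + 3) else pos (q u) + 1 / 2)" for u
  \<comment> \<open>Intervals are closed and touching counts: \<open>pos u + 1 / 2\<close> just
    reaches a leaf over \<open>u\<close> and its successor, \<open>pos u + 1\<close> just reaches
    the successor itself.\<close>
  define r where "r u = (if u \<in> P then (if \<exists>b\<in>P. {u, b} \<in> edges I \<and> pos b = pos u + 1 then real_of_int (pos u) + 1 else pos u + 1 / 2)
     else if sg u then pos (q u) + 1 / (real u + 3) else pos (q u) + 1)" for u
  have frac: "0 < 1 / (real u + 3)" "1 / (real u + 3) < 1 / 2" for u by (auto simp: field_simps)
  have lr: "l u \<le> r u" for u by (auto simp: l_def r_def)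
  have meet: "{l u..r u} \<inter> {l v..r v} \<noteq> {} \<longleftrightarrow> l u \<le> r v \<and> l v \<le> r u" for u v
    using lr[of u] lr[of v] by (auto simp: Int_atLeastAtMost)
  have PP: "{a, b} \<in> edges I \<longleftrightarrow> l a \<le> r b \<and> l b \<le> r a"
    if ab: "a \<in> P" "b \<in> P" "pos a < pos b" for a b
  proof
    assume e: "{a, b} \<in> edges I"
    then have "pos b = pos a + 1" using spine ab by fastforce
    then show "l a \<le> r b \<and> l b \<le> r a" using e ab by (auto simp: l_def r_def)
  next
    assume "l a \<le> r b \<and> l b \<le> r a"
    then have le: "real_of_int (pos b) \<le> r a" using ab by (simp add: l_def)
    have "\<exists>b'\<in>P. {a, b'} \<in> edges I \<and> pos b' = pos a + 1"
    proof (rule ccontr)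
      assume "\<not> ?thesis"
      then have "r a = pos a + 1 / 2" using ab by (auto simp: r_def)
      then show False using le ab by linarith
    qed
    then obtain b' where b': "b' \<in> P" "{a, b'} \<in> edges I" "pos b' = pos a + 1" by blast
    have "r a = pos a + 1" using b' ab by (auto simp: r_def)
    then have "pos b = pos b'" using le ab b' by linarith
    then show "{a, b} \<in> edges I" using b' ab inj by (metis inj_onD)
  qed
  have LP: "{a, u} \<in> edges I \<longleftrightarrow> l a \<le> r u \<and> l u \<le> r a" if au: "a \<in> P" "u \<in> L" for a u
  proof -
    have uP: "u \<notin> P" using au PL by auto
    have e: "{a, u} \<in> edges I \<longleftrightarrow> a \<in> N u" by (simp add: N_def)
    have qP: "q u \<in> P" using q au by blast
    have ra: "r a = pos a + 1 \<or> r a = pos a + 1 / 2" using au by (auto simp: r_def)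
    have la: "l a = pos a" using au by (simp add: l_def)
    show ?thesis
    proof (cases "sg u")
      case True
      have "a \<in> N u \<longleftrightarrow> pos a = pos (q u)" using True inj au qP by (auto simp: sg_def inj_on_def)
      moreover have "l u = pos (q u) + 1 / (real u + 3)" "r u = l u" using True uP by (auto simp: l_def r_def)
      moreover have "l a \<le> r u \<and> l u \<le> r a \<longleftrightarrow> pos a = pos (q u)"
        unfolding la calculation using ra frac[of u] by (auto; linarith)
      ultimately show ?thesis using e by simp
    next
      case False
      then obtain b where b: "b \<in> P" "N u = {q u, b}" "pos b = pos (q u) + 1" using q au by (auto simp: sg_def)
      have "a \<in> N u \<longleftrightarrow> pos a = pos (q u) \<or> pos a = pos (q u) + 1"
        using b inj au qP by (auto simp: inj_on_def)
      moreover have "l u = pos (q u) + 1 / 2" "r u = pos (q u) + 1" using False uP by (auto simp: l_def r_def)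
      moreover have "l a \<le> r u \<and> l u \<le> r a \<longleftrightarrow> pos a = pos (q u) \<or> pos a = pos (q u) + 1"
        unfolding la calculation using ra by (auto; linarith)
      ultimately show ?thesis using e by simp
    qed
  qed
  have LL: "{u, v} \<notin> edges I \<and> \<not> (l u \<le> r v \<and> l v \<le> r u)" if uv: "u \<in> L" "v \<in> L" "u \<noteq> v" for u v
  proof -
    have P: "u \<notin> P" "v \<notin> P" using uv PL by auto
    have "N v \<subseteq> P" using q uv by fastforce
    then have e: "{u, v} \<notin> edges I" using P by (auto simp: N_def)
    have qP: "q u \<in> P" "q v \<in> P" using q uv by auto
    have "\<not> (l u \<le> r v \<and> l v \<le> r u)"
    proof
      assume le: "l u \<le> r v \<and> l v \<le> r u"
      have bu: "pos (q u) < l u" "l u \<le> r u" "r u \<le> pos (q u) + 1" and bv: "pos (q v) < l v" "r v \<le> pos (q v) + 1"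
        using frac[of u] frac[of v] P by (auto simp: l_def r_def)
      then have "pos (q u) = pos (q v)" using le by linarith
      then have qq: "q u = q v" using qP inj by (auto simp: inj_on_def)
      show False
      proof (cases "sg u")
        case su: True
        show False
        proof (cases "sg v")
          case True
          then have "1 / (real u + 3) = 1 / (real v + 3)" using su qq le P by (auto simp: l_def r_def)
          then show False using uv by (simp add: field_simps)
        next
          case False
          then show False using su qq le P frac[of u] by (auto simp: l_def r_def)
        qed
      next
        case su: False
        show False
        proof (cases "sg v")
          case True
          then show False using su qq le P frac[of v] by (auto simp: l_def r_def)
        next
          case False
          obtain b where b: "b \<in> P" "N u = {q u, b}" "pos b = pos (q u) + 1" using q uv su by (auto simp: sg_def)
          obtain b' where b': "b' \<in> P" "N v = {q v, b'}" "pos b' = pos (q v) + 1" using q uv False by (auto simp: sg_def)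
          have "b = b'" using b b' qq inj by (auto simp: inj_on_def)
          moreover have "q u \<noteq> b" using b by auto
          ultimately have "u = v" using uniq[of u v "q u" b] b b' qq uv by (auto simp: N_def)
          then show False using uv by simp
        qed
      qed
    qed
    then show ?thesis using e by simp
  qed
  have "{u, v} \<in> edges I \<longleftrightarrow> {l u..r u} \<inter> {l v..r v} \<noteq> {}"
    if uv: "u \<in> verts I" "v \<in> verts I" "u \<noteq> v" for u v
  proof -
    consider "u \<in> P" "v \<in> P" "pos u < pos v" | "u \<in> P" "v \<in> P" "pos v < pos u"
      | "u \<in> P" "v \<in> L" | "u \<in> L" "v \<in> P" | "u \<in> L" "v \<in> L"
      using uv PL inj by (metis UnE inj_onD linorder_neqE)
    then have "{u, v} \<in> edges I \<longleftrightarrow> l u \<le> r v \<and> l v \<le> r u"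
    proof cases
      case 1
      then show ?thesis using PP by simp
    next
      case 2
      then have "{v, u} \<in> edges I \<longleftrightarrow> l v \<le> r u \<and> l u \<le> r v" using PP by simp
      then show ?thesis by (metis insert_commute)
    next
      case 3
      then show ?thesis using LP by simp
    next
      case 4
      then have "{v, u} \<in> edges I \<longleftrightarrow> l v \<le> r u \<and> l u \<le> r v" using LP by simp
      then show ?thesis by (metis insert_commute)
    next
      case 5
      then show ?thesis using LL uv by blast
    qed
    then show ?thesis by (simp only: meet)
  qed
  then show ?thesis
    unfolding interval_graph_def using I lr
    by (intro conjI exI[of _ "\<lambda>u. {l u..r u}"]) (auto simp: is_interval_1)
qed

text \<open>The apex takes the whole line, which meets every nonempty interval.\<close>

lemma interval_graph_cone:
  assumes I: "interval_graph I" and w: "w \<notin> verts I"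
  shows "interval_graph \<lparr>verts = insert w (verts I), edges = edges I \<union> {{w, u} |u. u \<in> verts I}\<rparr>"
proof -
  obtain J :: "'a \<Rightarrow> real set" where
    f: "finite (verts I)" and EI: "edges I \<subseteq> nsets (verts I) 2" and
    J1: "\<And>v. v \<in> verts I \<Longrightarrow> is_interval (J v) \<and> J v \<noteq> {}" and
    J2: "\<And>u v. u \<in> verts I \<Longrightarrow> v \<in> verts I \<Longrightarrow> u \<noteq> v \<Longrightarrow> {u, v} \<in> edges I \<longleftrightarrow> J u \<inter> J v \<noteq> {}"
    using I by (rule interval_graphE) blast
  have "nsets (verts I) 2 \<subseteq> nsets (insert w (verts I)) 2" by (auto simp: nsets_def)
  then have "simple_graph \<lparr>verts = insert w (verts I), edges = edges I \<union> {{w, u} |u. u \<in> verts I}\<rparr>"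
    using EI f w by (auto simp: simple_graph_def)
  moreover have "{u, w} \<notin> edges I" "{w, u} \<notin> edges I" for u using EI w by auto
  ultimately show ?thesis
    unfolding interval_graph_def using J1 J2 w
    by (intro conjI exI[of _ "J(w := UNIV)"]) (auto simp: doubleton_eq_iff)
qed

subsection \<open>Width at least three\<close>

text \<open>
  Every vertex \<open>w\<close> carries one interval graph, a cone with apex \<open>w\<close> over a star forest.  \<open>D u\<close> is
  the set of apices \<open>w\<close> whose cones \<open>u\<close> joins, and \<open>S u = Some (y, w)\<close> says that the edge \<open>{u, y}\<close>
  is covered in the cone of \<open>w\<close>, with \<open>u\<close> a leaf attached to the centre \<open>y\<close>.  An available clique
  either contains a centre together with its apex, or reserves for one of its vertices the right
  to join one more cone.
\<close>

locale hub_cover =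
  fixes E :: "nat set set" and k :: nat and V :: "nat set" and H :: "nat set set"
    and A :: "(nat set \<times> bool) set" and D :: "nat \<Rightarrow> nat set" and S :: "nat \<Rightarrow> (nat \<times> nat) option"
    and res :: "nat set \<times> bool \<Rightarrow> nat option"
  assumes apex: "\<And>u w. u \<in> V \<Longrightarrow> w \<in> D u \<Longrightarrow> w \<in> V \<and> w \<noteq> u \<and> {u, w} \<in> E"
    and leaf: "\<And>u y w. u \<in> V \<Longrightarrow> S u = Some (y, w) \<Longrightarrow>
      y \<in> V \<and> y \<noteq> u \<and> w \<in> D u \<and> w \<in> D y \<and> {u, y} \<in> E \<and> (\<forall>z. S y \<noteq> Some (z, w))"
    and covered: "\<And>a b. {a, b} \<in> H \<Longrightarrow> {a, b} \<in> E \<Longrightarrow>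
      a \<in> D b \<or> b \<in> D a \<or> (\<exists>w. S a = Some (b, w)) \<or> (\<exists>w. S b = Some (a, w))"
    and slack: "\<And>u. u \<in> V \<Longrightarrow> card (D u) + card {a \<in> A. res a = Some u} < k"
    and reserved: "\<And>C t y. (C, t) \<in> A \<Longrightarrow> res (C, t) = Some y \<Longrightarrow> y \<in> C"
    and good: "\<And>C t. (C, t) \<in> A \<Longrightarrow> res (C, t) = None \<Longrightarrow>
      \<exists>y\<in>C. \<exists>w\<in>C. w \<in> D y \<and> (\<forall>z. S y \<noteq> Some (z, w))"
begin

text \<open>Reduces a construction step to four choices: the cones \<open>Dv\<close> that
  \<open>v\<close> joins, the vertices selected by \<open>grow\<close> that join the cone of
  \<open>v\<close>, the attachment \<open>Sv\<close> of \<open>v\<close> as a leaf, and the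
  reservation \<open>T c\<close> on the new clique omitting \<open>c\<close>. Costs at old vertices
  must be paid by the reservation that the used clique sets free (\<open>e6\<close>); all others
  fall on \<open>v\<close> (\<open>e5\<close>).\<close>

lemma extend:
  assumes build: "clique_build k V H A" and C: "(C, t) \<in> A" and v: "v \<notin> V"
    and e1: "\<And>w. w \<in> Dv \<Longrightarrow> w \<in> C \<and> {v, w} \<in> E"
    and e2: "\<And>u. grow u \<Longrightarrow> u \<in> C \<and> {v, u} \<in> E"
    and e3: "\<And>y w. Sv = Some (y, w) \<Longrightarrow>
      y \<in> C \<and> w \<in> Dv \<and> w \<in> D y \<and> {v, y} \<in> E \<and> (\<forall>z. S y \<noteq> Some (z, w))"
    and e4: "\<And>c. c \<in> C \<Longrightarrow> {v, c} \<in> E \<Longrightarrow> c \<in> Dv \<or> grow c \<or> (\<exists>w. Sv = Some (c, w))"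
    and e5: "card Dv + card {c \<in> C. T c = Some v} < k"
    and e6: "\<And>u. u \<in> V \<Longrightarrow> (if grow u then 1 else 0) + card {c \<in> C. T c = Some u}
      \<le> (if res (C, t) = Some u then 1 else 0 :: nat)"
    and e7: "\<And>c y. c \<in> C \<Longrightarrow> T c = Some y \<Longrightarrow> y = v \<or> y \<in> C - {c}"
    and e8: "\<And>c. c \<in> C \<Longrightarrow> T c = None \<Longrightarrow>
      (\<exists>y\<in>C - {c}. \<exists>w\<in>C - {c}. w \<in> D y \<and> (\<forall>z. S y \<noteq> Some (z, w))) \<or>
      (\<exists>x\<in>C - {c}. x \<in> Dv \<and> (\<forall>z. Sv \<noteq> Some (z, x)))"
  shows "\<exists>D' S' res'. hub_cover E k (insert v V) (H \<union> {{v, c} |c. c \<in> C})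
      (A - {(C, t)} \<union> (\<lambda>c. (insert v (C - {c}), False)) ` C) D' S' res'"
proof -
  note wf = clique_build_wf[OF build]
  have CV: "C \<subseteq> V" and fC: "finite C" using wf(4)[OF C] by auto
  have vC: "v \<notin> C" using CV v by blast
  define D' where "D' u = (if u = v then Dv else if grow u then insert v (D u) else D u)" for u
  define S' where "S' = S(v := Sv)"
  \<comment> \<open>A clique containing \<open>v\<close> is new, and the vertex it omits is the only
    element of \<open>C\<close> outside it.\<close>
  define res' where "res' a = (if v \<in> fst a then T (the_elem (C - fst a)) else res a)" for a
  define f where "f c = (insert v (C - {c}), False)" for c
  define A' where "A' = A - {(C, t)} \<union> f ` C"
  have old: "v \<notin> K" "res' (K, s) = res (K, s)" if "(K, s) \<in> A" for K s
  proof -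
    show "v \<notin> K" using wf(4)[OF that] v by blast
    then show "res' (K, s) = res (K, s)" by (simp add: res'_def)
  qed
  have new: "res' (f c) = T c" if "c \<in> C" for c
  proof -
    have "C - insert v (C - {c}) = {c}" using that vC by blast
    then show ?thesis by (simp add: res'_def f_def)
  qed
  have D'V: "D u \<subseteq> D' u" "S' u = S u" if "u \<in> V" for u
    using that v by (auto simp: D'_def S'_def)
  have D'v: "D' v = Dv" "S' v = Sv" by (auto simp: D'_def S'_def)
  have DV: "D u \<subseteq> V" if "u \<in> V" for u using apex[OF that] by blast
  have sub: "{a \<in> A'. res' a = Some u} \<subseteq>
    {a \<in> A - {(C, t)}. res a = Some u} \<union> f ` {c \<in> C. T c = Some u}" for u
    using old(2) new by (auto simp: A'_def)
  have "hub_cover E k (insert v V) (H \<union> {{v, c} |c. c \<in> C}) A' D' S' res'"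
  proof (rule hub_cover.intro)
    fix u w assume u: "u \<in> insert v V" and w: "w \<in> D' u"
    show "w \<in> insert v V \<and> w \<noteq> u \<and> {u, w} \<in> E"
    proof (cases "u = v")
      case True
      then have "w \<in> C \<and> {v, w} \<in> E" using e1[of w] w D'v by simp
      then show ?thesis using True vC CV by blast
    next
      case False
      then have uV: "u \<in> V" using u by simp
      show ?thesis
      proof (cases "w \<in> D u")
        case True
        then show ?thesis using apex[OF uV] by blast
      next
        case wD: False
        then have "grow u" "w = v" using w False by (auto simp: D'_def split: if_splits)
        then show ?thesis using e2[of u] False by (simp add: insert_commute)
      qed
    qed
  next
    fix u y w assume u: "u \<in> insert v V" and s: "S' u = Some (y, w)"
    show "y \<in> insert v V \<and> y \<noteq> u \<and> w \<in> D' u \<and> w \<in> D' y \<and> {u, y} \<in> E \<and> (\<forall>z. S' y \<noteq> Some (z, w))"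
    proof (cases "u = v")
      case True
      then have *: "y \<in> C \<and> w \<in> Dv \<and> w \<in> D y \<and> {v, y} \<in> E \<and> (\<forall>z. S y \<noteq> Some (z, w))"
        using e3 s D'v by simp
      then have "y \<in> V" using CV by blast
      then show ?thesis using * D'V[of y] D'v True v by auto
    next
      case False
      then have uV: "u \<in> V" using u by simp
      then have "S u = Some (y, w)" using s D'V by simp
      from leaf[OF uV this]
      have *: "y \<in> V" "y \<noteq> u" "w \<in> D u" "w \<in> D y" "{u, y} \<in> E" "\<forall>z. S y \<noteq> Some (z, w)" by auto
      then show ?thesis using D'V[OF uV] D'V[OF *(1)] by auto
    qed
  next
    fix a b assume H: "{a, b} \<in> H \<union> {{v, c} |c. c \<in> C}" and E: "{a, b} \<in> E"
    show "a \<in> D' b \<or> b \<in> D' a \<or> (\<exists>w. S' a = Some (b, w)) \<or> (\<exists>w. S' b = Some (a, w))"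
    proof (cases "{a, b} \<in> H")
      case True
      then have ab: "a \<in> V" "b \<in> V" using wf(3) by auto
      show ?thesis using covered[OF True E] D'V[OF ab(1)] D'V[OF ab(2)] by auto
    next
      case False
      have *: "c \<in> D' v \<or> v \<in> D' c \<or> (\<exists>w. S' v = Some (c, w))" if c: "c \<in> C" "{v, c} \<in> E" for c
      proof -
        have "c \<noteq> v" using c vC by blast
        then show ?thesis using e4[OF c] D'v by (auto simp: D'_def)
      qed
      from False H obtain c where "c \<in> C" "{a, b} = {v, c}" by auto
      then consider "a = v" "b \<in> C" | "b = v" "a \<in> C" by (auto simp: doubleton_eq_iff)
      then show ?thesis
      proof cases
        case 1
        then show ?thesis using *[of b] E by blast
      next
        case 2
        then show ?thesis using *[of a] E by (auto simp: insert_commute)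
      qed
    qed
  next
    fix u assume u: "u \<in> insert v V"
    have fin: "finite {a \<in> A - {(C, t)}. res a = Some u}" "finite (f ` {c \<in> C. T c = Some u})"
      using wf(2) fC by auto
    have le: "card {a \<in> A'. res' a = Some u} \<le>
      card {a \<in> A - {(C, t)}. res a = Some u} + card {c \<in> C. T c = Some u}"
      using card_mono[OF finite_UnI[OF fin] sub[of u]] card_image_le[of "{c \<in> C. T c = Some u}" f] fC
        card_Un_le[of "{a \<in> A - {(C, t)}. res a = Some u}" "f ` {c \<in> C. T c = Some u}"]
      by simp
    show "card (D' u) + card {a \<in> A'. res' a = Some u} < k"
    proof (cases "u = v")
      case True
      have "res a \<noteq> Some v" if "a \<in> A" for a
      proof (cases a)
        case (Pair K s)
        then show ?thesis using reserved[of K s v] old(1)[of K s] that by auto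
      qed
      then have none: "{a \<in> A - {(C, t)}. res a = Some u} = {}" using True by blast
      show ?thesis using le e5 D'v(1) True unfolding none by simp
    next
      case False
      then have uV: "u \<in> V" using u by simp
      have fD: "finite (D u)" using DV[OF uV] wf(1) finite_subset by blast
      have d: "card (D' u) \<le> card (D u) + (if grow u then 1 else 0)"
        using False fD by (simp add: D'_def card_insert_if)
      \<comment> \<open>The used clique leaves \<open>A\<close> and thereby returns its reserved
        place.\<close>
      have "card {a \<in> A - {(C, t)}. res a = Some u} + (if res (C, t) = Some u then 1 else 0)
        \<le> card {a \<in> A. res a = Some u}"
      proof (cases "res (C, t) = Some u")
        case True
        have "{a \<in> A. res a = Some u} = insert (C, t) {a \<in> A - {(C, t)}. res a = Some u}"
          using True C by auto
        then show ?thesis using True fin by simp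
      next
        case False
        have "{a \<in> A - {(C, t)}. res a = Some u} \<subseteq> {a \<in> A. res a = Some u}" by auto
        then show ?thesis using False wf(2) by (simp add: card_mono)
      qed
      then show ?thesis using le d e6[OF uV] slack[OF uV] by linarith
    qed
  next
    fix K s y assume K: "(K, s) \<in> A'" and r: "res' (K, s) = Some y"
    show "y \<in> K"
    proof (cases "(K, s) \<in> A")
      case True
      then show ?thesis using reserved[OF True] old(2)[OF True] r by simp
    next
      case False
      then obtain c where c: "c \<in> C" "(K, s) = f c" using K by (auto simp: A'_def)
      then have "T c = Some y" using new[OF c(1)] r by simp
      then show ?thesis using e7[OF c(1)] c(2) by (auto simp: f_def)
    qed
  next
    fix K s assume K: "(K, s) \<in> A'" and r: "res' (K, s) = None"
    show "\<exists>y\<in>K. \<exists>w\<in>K. w \<in> D' y \<and> (\<forall>z. S' y \<noteq> Some (z, w))"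
    proof (cases "(K, s) \<in> A")
      case True
      have KV: "K \<subseteq> V" using wf(4)[OF True] by simp
      from good[OF True] old(2)[OF True] r
      obtain y w where yw: "y \<in> K" "w \<in> K" "w \<in> D y" "\<forall>z. S y \<noteq> Some (z, w)" by auto
      have "y \<in> V" using yw KV by blast
      then have "w \<in> D' y \<and> (\<forall>z. S' y \<noteq> Some (z, w))" using yw D'V[of y] by auto
      then show ?thesis using yw by blast
    next
      case False
      then obtain c where c: "c \<in> C" "(K, s) = f c" using K by (auto simp: A'_def)
      then have Keq: "K = insert v (C - {c})" by (simp add: f_def)
      have Tc: "T c = None" using new[OF c(1)] c(2) r by simp
      from e8[OF c(1) Tc] show ?thesis
      proof
        assume "\<exists>y\<in>C - {c}. \<exists>w\<in>C - {c}. w \<in> D y \<and> (\<forall>z. S y \<noteq> Some (z, w))"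
        then obtain y w where yw: "y \<in> C - {c}" "w \<in> C - {c}" "w \<in> D y" "\<forall>z. S y \<noteq> Some (z, w)"
          by blast
        have "y \<in> V" using yw CV by blast
        then have "w \<in> D' y \<and> (\<forall>z. S' y \<noteq> Some (z, w))" using yw D'V[of y] by auto
        then show ?thesis using yw(1,2) unfolding Keq by blast
      next
        assume "\<exists>x\<in>C - {c}. x \<in> Dv \<and> (\<forall>z. Sv \<noteq> Some (z, x))"
        then obtain x where "x \<in> C - {c}" "x \<in> D' v \<and> (\<forall>z. S' v \<noteq> Some (z, x))"
          unfolding D'v by blast
        then show ?thesis unfolding Keq by blast
      qed
    qed
  qed
  then show ?thesis unfolding A'_def f_def by blast
qed

text \<open>The invariant is restored once each new clique is good or has a reservation. It is good
  if it keeps the old centre with its apex, or if it keeps some \<open>x\<close> in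
  \<open>Dv\<close> in whose cone \<open>v\<close> is not a leaf, because \<open>v\<close> is then a
  centre there.\<close>

lemma step:
  assumes k: "3 \<le> k" and build: "clique_build k V H A" and C: "(C, t) \<in> A" and v: "v \<notin> V"
  shows "\<exists>D' S' res'. hub_cover E k (insert v V) (H \<union> {{v, c} |c. c \<in> C})
      (A - {(C, t)} \<union> (\<lambda>c. (insert v (C - {c}), False)) ` C) D' S' res'"
proof -
  note wf = clique_build_wf[OF build]
  have CV: "C \<subseteq> V" and fC: "finite C" and cardC: "card C = k" using wf(4)[OF C] by auto
  have vC: "v \<notin> C" using CV v by blast
  \<comment> \<open>Here \<open>3 \<le> k\<close> is used: \<open>C\<close> has a vertex besides any
    two given ones.\<close>
  have third: "\<exists>x. x \<in> C \<and> x \<noteq> a \<and> x \<noteq> b" for a b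
  proof (rule ccontr)
    assume "\<not> ?thesis"
    then have "C \<subseteq> {a, b}" by blast
    then have "card C \<le> card {a, b}" by (intro card_mono) auto
    also have "\<dots> \<le> 2" by (simp add: card_insert_if)
    finally show False using cardC k by simp
  qed
  define X where "X = {c \<in> C. {v, c} \<in> E}"
  consider (full_good) y w where "X = C" "res (C, t) = None" "y \<in> C" "w \<in> C" "w \<in> D y" "\<forall>z. S y \<noteq> Some (z, w)"
    | (full_res) y where "X = C" "res (C, t) = Some y" "y \<in> C"
    | (part) "X \<noteq> C" "X \<noteq> {}" | (empty) "X = {}"
  proof (cases "X = C")
    case True
    show ?thesis
    proof (cases "res (C, t)")
      case None
      then show ?thesis using good[OF C None] that(1) True by blast
    next
      case (Some y)
      then show ?thesis using reserved[OF C Some] that(2) True by blast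
    qed
  next
    case False
    then show ?thesis using that(3,4) by blast
  qed
  then show ?thesis
  proof cases
    case (full_good y w)
    have E: "{v, c} \<in> E" if "c \<in> C" for c using that full_good(1) by (auto simp: X_def)
    have wy: "w \<noteq> y" using apex[of y w] full_good CV by blast
    \<comment> \<open>\<open>v\<close> is a leaf in the cone of \<open>w\<close> only. If
      \<open>y\<close> and \<open>w\<close> both survive in a new clique, they keep it good;
      otherwise a third vertex \<open>x\<close> does, with \<open>v\<close> as a centre in its
      cone.\<close>
    show ?thesis
    proof (rule extend[OF build C v, where Dv = "C - {y}" and grow = "\<lambda>_. False"
        and Sv = "Some (y, w)" and T = "\<lambda>_. None"])
      show "card (C - {y}) + card {c \<in> C. None = Some v} < k"
        using full_good fC cardC k by simp
    next
      fix c assume c: "c \<in> C"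
      show "(\<exists>y\<in>C - {c}. \<exists>w\<in>C - {c}. w \<in> D y \<and> (\<forall>z. S y \<noteq> Some (z, w))) \<or>
        (\<exists>x\<in>C - {c}. x \<in> C - {y} \<and> (\<forall>z. Some (y, w) \<noteq> Some (z, x)))"
      proof (cases "c = y \<or> c = w")
        case True
        obtain x where "x \<in> C" "x \<noteq> y" "x \<noteq> w" using third by blast
        then show ?thesis using True by (intro disjI2 bexI[of _ x]) auto
      next
        case False
        then show ?thesis using full_good by (intro disjI1 bexI[of _ y] bexI[of _ w]) auto
      qed
    qed (use E full_good wy in auto)
  next
    case (full_res y)
    have E: "{v, c} \<in> E" if "c \<in> C" for c using that full_res(1) by (auto simp: X_def)
    \<comment> \<open>The place reserved at \<open>y\<close> is spent on the cone of
      \<open>v\<close>. Since \<open>v\<close> is a leaf nowhere, any \<open>x\<close> other than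
      \<open>y\<close> and the omitted vertex makes a new clique good.\<close>
    show ?thesis
    proof (rule extend[OF build C v, where Dv = "C - {y}" and grow = "\<lambda>u. u = y"
        and Sv = None and T = "\<lambda>_. None"])
      show "card (C - {y}) + card {c \<in> C. None = Some v} < k"
        using full_res fC cardC k by simp
    next
      fix c assume c: "c \<in> C"
      obtain x where "x \<in> C" "x \<noteq> y" "x \<noteq> c" using third by blast
      then show "(\<exists>y\<in>C - {c}. \<exists>w\<in>C - {c}. w \<in> D y \<and> (\<forall>z. S y \<noteq> Some (z, w))) \<or>
        (\<exists>x\<in>C - {c}. x \<in> C - {y} \<and> (\<forall>z. None \<noteq> Some (z, x)))"
        by (intro disjI2 bexI[of _ x]) auto
    qed (use E full_res in auto)
  next
    case part
    have XC: "X \<subset> C" using part by (auto simp: X_def)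
    have fX: "finite X" using XC fC finite_subset by blast
    \<comment> \<open>\<open>v\<close> joins at most \<open>k - 1\<close> cones. Only when
      \<open>X\<close> is a single vertex does some new clique miss all of \<open>X\<close>; that
      clique reserves a place at \<open>v\<close>, which is affordable because
      \<open>1 + 1 < k\<close>.\<close>
    show ?thesis
    proof (rule extend[OF build C v, where Dv = X and grow = "\<lambda>u. False"
        and Sv = None and T = "\<lambda>c. if X = {c} then Some v else None"])
      show "card X + card {c \<in> C. (if X = {c} then Some v else None) = Some v} < k"
      proof (cases "\<exists>c. X = {c}")
        case True
        then obtain c where c: "X = {c}" by blast
        then have "{c \<in> C. (if X = {c} then Some v else None) = Some v} \<subseteq> {c}" by auto
        from card_mono[OF _ this] show ?thesis using c k by simp
      next
        case False
        then have none: "{c \<in> C. (if X = {c} then Some v else None) = Some v} = {}" by auto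
        show ?thesis using psubset_card_mono[OF fC XC] cardC unfolding none by simp
      qed
    next
      fix c assume c: "c \<in> C" "(if X = {c} then Some v else None) = None"
      then have "X \<noteq> {c}" by (auto split: if_splits)
      then obtain x where "x \<in> X" "x \<noteq> c" using part by blast
      then show "(\<exists>y\<in>C - {c}. \<exists>w\<in>C - {c}. w \<in> D y \<and> (\<forall>z. S y \<noteq> Some (z, w))) \<or>
        (\<exists>x\<in>C - {c}. x \<in> X \<and> (\<forall>z. None \<noteq> Some (z, x)))"
        using XC by (intro disjI2 bexI[of _ x]) auto
    next
      fix u assume "u \<in> V"
      then have "u \<noteq> v" using v by blast
      then have "{c \<in> C. (if X = {c} then Some v else None) = Some u} = {}" by auto
      then show "(if False then 1 else 0) + card {c \<in> C. (if X = {c} then Some v else None) = Some u}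
        \<le> (if res (C, t) = Some u then 1 else 0 :: nat)"
        by (simp only: card.empty if_False)
    qed (auto simp: X_def split: if_splits)
  next
    case empty
    \<comment> \<open>One new clique inherits the state of \<open>C\<close>, so \<open>c0\<close>
      must avoid the reserved vertex, or the centre and its apex. The other \<open>k - 1\<close>
      cliques reserve places at \<open>v\<close>, which joins no cone; \<open>k\<close> reservations
      would exceed its room.\<close>
    obtain c0 where c0: "c0 \<in> C" "\<And>y. res (C, t) = Some y \<Longrightarrow> y \<in> C - {c0}"
      "res (C, t) = None \<Longrightarrow> \<exists>y\<in>C - {c0}. \<exists>w\<in>C - {c0}. w \<in> D y \<and> (\<forall>z. S y \<noteq> Some (z, w))"
    proof (cases "res (C, t)")
      case None
      obtain y w where yw: "y \<in> C" "w \<in> C" "w \<in> D y" "\<forall>z. S y \<noteq> Some (z, w)"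
        using good[OF C None] by blast
      obtain x where x: "x \<in> C" "x \<noteq> y" "x \<noteq> w" using third by blast
      have "\<exists>y\<in>C - {x}. \<exists>w\<in>C - {x}. w \<in> D y \<and> (\<forall>z. S y \<noteq> Some (z, w))"
        using yw x by (intro bexI[of _ y] bexI[of _ w]) auto
      then show ?thesis using that[OF x(1)] None by simp
    next
      case (Some y)
      obtain x where x: "x \<in> C" "x \<noteq> y" using third by blast
      show ?thesis using that[OF x(1)] reserved[OF C Some] x Some by simp
    qed
    define T where "T c = (if c = c0 then res (C, t) else Some v)" for c
    have rv: "res (C, t) \<noteq> Some v" using c0(2) vC by blast
    have noE: "{v, c} \<notin> E" if "c \<in> C" for c using that empty by (auto simp: X_def)
    show ?thesis
    proof (rule extend[OF build C v, where Dv = "{}" and grow = "\<lambda>u. False" and Sv = None and T = T])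
      have "{c \<in> C. T c = Some v} \<subseteq> C - {c0}" using rv by (auto simp: T_def)
      then have "card {c \<in> C. T c = Some v} \<le> card (C - {c0})" using fC by (intro card_mono) auto
      then show "card {} + card {c \<in> C. T c = Some v} < k" using c0(1) fC cardC k by simp
    next
      fix u assume "u \<in> V"
      then have "u \<noteq> v" using v by blast
      then have "{c \<in> C. T c = Some u} \<subseteq> (if res (C, t) = Some u then {c0} else {})"
        by (auto simp: T_def split: if_splits)
      then have "card {c \<in> C. T c = Some u} \<le> card (if res (C, t) = Some u then {c0} else {})"
        by (intro card_mono) auto
      then show "(if False then 1 else 0) + card {c \<in> C. T c = Some u}
        \<le> (if res (C, t) = Some u then 1 else 0 :: nat)"
        by (cases "res (C, t) = Some u") auto
    next
      fix c y assume c: "c \<in> C" "T c = Some y"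
      then show "y = v \<or> y \<in> C - {c}" using c0(2)[of y] by (auto simp: T_def split: if_splits)
    next
      fix c assume c: "c \<in> C" "T c = None"
      then have "c = c0" "res (C, t) = None" by (auto simp: T_def split: if_splits)
      then show "(\<exists>y\<in>C - {c}. \<exists>w\<in>C - {c}. w \<in> D y \<and> (\<forall>z. S y \<noteq> Some (z, w))) \<or>
        (\<exists>x\<in>C - {c}. x \<in> {} \<and> (\<forall>z. None \<noteq> Some (z, x)))"
        using c0(3) by simp
    qed (use noE in auto)
  qed
qed

end

lemma clique_build_hub_cover:
  assumes "clique_build k V H A" and k: "3 \<le> k"
  shows "\<exists>D S res. hub_cover E k V H A D S res"
  using assms(1)
proof (induction rule: clique_build.induct)
  case (base B)
  define D where "D u = {w \<in> B. w < u \<and> {u, w} \<in> E}" for u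
  \<comment> \<open>Base vertices join only the cones of smaller neighbours, so the smallest one
    joins none and has room for the reservations of both copies of the base clique:
    \<open>2 < k\<close>.\<close>
  define m where "m = Min B"
  have B: "finite B" "card B = k" "B \<noteq> {}" using base k by auto
  have mB: "m \<in> B" "\<And>b. b \<in> B \<Longrightarrow> m \<le> b" using B by (auto simp: m_def)
  have "hub_cover E k B (nsets B 2) {(B, False), (B, True)} D (\<lambda>_. None) (\<lambda>_. Some m)"
  proof (rule hub_cover.intro)
    fix a b assume "{a, b} \<in> nsets B 2" and E: "{a, b} \<in> E"
    then have "a \<in> B" "b \<in> B" "a < b \<or> b < a" by auto
    then have "a \<in> D b \<or> b \<in> D a" using E by (auto simp: D_def insert_commute)
    then show "a \<in> D b \<or> b \<in> D a \<or> (\<exists>w. None = Some (b, w)) \<or> (\<exists>w. None = Some (a, w))" by blast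
  next
    fix u assume u: "u \<in> B"
    show "card (D u) + card {a \<in> {(B, False), (B, True)}. Some m = Some u} < k"
    proof (cases "u = m")
      case True
      have "D u = {}" using True mB(2) by (auto simp: D_def dest: leD)
      moreover have "card {a \<in> {(B, False), (B, True)}. Some m = Some u} \<le> card {(B, False), (B, True)}"
        by (intro card_mono) auto
      ultimately show ?thesis using k by simp
    next
      case False
      have "D u \<subseteq> B - {u}" by (auto simp: D_def)
      then have "card (D u) \<le> card (B - {u})" using B by (intro card_mono) auto
      moreover have "{a \<in> {(B, False), (B, True)}. Some m = Some u} = {}" using False by simp
      ultimately show ?thesis using B u k by (simp only: card.empty card_Diff_singleton)
    qed
  qed (use mB in \<open>auto simp: D_def\<close>)
  then show ?case by blast
next
  case (step V H A C t v)
  then obtain D S res where "hub_cover E k V H A D S res" by blast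
  from hub_cover.step[OF this k step.hyps] show ?case .
qed

lemma simple_graph_map_graph:
  assumes "simple_graph G" "inj_on f (verts G)"
  shows "simple_graph (map_graph f G)"
proof -
  have "f ` e \<in> nsets (f ` verts G) 2" if e: "e \<in> nsets (verts G) 2" for e
  proof -
    obtain a b where ab: "e = {a, b}" "a \<in> verts G" "b \<in> verts G" "a \<noteq> b"
      using e by (rule nsets2_E)
    then have "f a \<noteq> f b" using assms(2) by (meson inj_onD)
    then show ?thesis using ab by simp
  qed
  then show ?thesis using assms(1) by (auto simp: simple_graph_def map_graph_def)
qed

text \<open>By \<open>leaf\<close>, a leaf hangs on a vertex that is not a leaf in the same cone, so
  all components are stars: a caterpillar without spine edges in which every leaf has one neighbour.
  Doubled positions are distinct and never consecutive.\<close>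

lemma (in hub_cover) interval_graph_star_forest:
  assumes "finite V"
  shows "interval_graph \<lparr>verts = {u \<in> V. w \<in> D u}, edges = {{u, y} |u y. u \<in> V \<and> S u = Some (y, w)}\<rparr>"
    (is "interval_graph ?F")
proof (rule interval_graph_caterpillar[where pos = "\<lambda>u. 2 * int u"
    and P = "{u \<in> V. w \<in> D u \<and> (\<forall>y. S u \<noteq> Some (y, w))}"
    and L = "{u \<in> V. w \<in> D u \<and> (\<exists>y. S u = Some (y, w))}"])
  have "e \<in> nsets (verts ?F) 2" if "e \<in> edges ?F" for e
  proof -
    from that obtain u y where e: "e = {u, y}" "u \<in> V" "S u = Some (y, w)" by auto
    then show ?thesis using leaf[OF e(2,3)] by simp
  qed
  then show "simple_graph ?F" using assms by (auto simp: simple_graph_def)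
next
  fix a b
  assume a: "a \<in> {u \<in> V. w \<in> D u \<and> (\<forall>y. S u \<noteq> Some (y, w))}"
    and b: "b \<in> {u \<in> V. w \<in> D u \<and> (\<forall>y. S u \<noteq> Some (y, w))}" and ab: "{a, b} \<in> edges ?F"
  from ab obtain u y where "{a, b} = {u, y}" "S u = Some (y, w)" by auto
  then have False using a b by (auto simp: doubleton_eq_iff)
  then show "\<bar>2 * int a - 2 * int b\<bar> = 1" ..
next
  have nbr: "y \<in> {u \<in> V. w \<in> D u \<and> (\<forall>y. S u \<noteq> Some (y, w))} \<and> {x. {x, u} \<in> edges ?F} = {y}"
    if u: "u \<in> V" "S u = Some (y, w)" for u y
  proof
    show "y \<in> {u \<in> V. w \<in> D u \<and> (\<forall>y. S u \<noteq> Some (y, w))}" using leaf[OF u] by simp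
    show "{x. {x, u} \<in> edges ?F} = {y}"
    proof (intro equalityI subsetI)
      fix x assume "x \<in> {x. {x, u} \<in> edges ?F}"
      then obtain u' y' where e: "{x, u} = {u', y'}" and u': "u' \<in> V" "S u' = Some (y', w)" by auto
      from leaf[OF u'] have "y' \<noteq> u" using u(2) by auto
      then show "x \<in> {y}" using e u' u by (auto simp: doubleton_eq_iff)
    next
      fix x assume "x \<in> {y}"
      then have "{x, u} = {u, y}" by auto
      then show "x \<in> {x. {x, u} \<in> edges ?F}" using u by auto
    qed
  qed
  fix u assume u: "u \<in> {u \<in> V. w \<in> D u \<and> (\<exists>y. S u = Some (y, w))}"
  then obtain y where y: "u \<in> V" "S u = Some (y, w)" by blast
  from nbr[OF y] show "\<exists>a\<in>{u \<in> V. w \<in> D u \<and> (\<forall>y. S u \<noteq> Some (y, w))}. {x. {x, u} \<in> edges ?F} = {a} \<or>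
    (\<exists>b\<in>{u \<in> V. w \<in> D u \<and> (\<forall>y. S u \<noteq> Some (y, w))}. {x. {x, u} \<in> edges ?F} = {a, b} \<and> 2 * int b = 2 * int a + 1)"
    by (intro bexI[of _ y]) simp_all
  fix a b :: nat assume "{x. {x, u} \<in> edges ?F} = {a, b}" "a \<noteq> b"
  moreover have "{x. {x, u} \<in> edges ?F} = {y}" using nbr[OF y] by simp
  ultimately show "u = u'" for u' by (metis doubleton_eq_iff insert_absorb2)
qed (auto simp: inj_on_def)

lemma local_track_number_le_if_clique_build_ge_3:
  fixes H :: "nat graph"
  assumes G: "simple_graph G" and f: "inj_on f (verts G)" and sub: "subgraph (map_graph f G) H"
    and build: "clique_build k (verts H) (edges H) A" and k: "3 \<le> k"
  shows "local_track_number G \<le> k"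
proof -
  define G' where "G' = map_graph f G"
  have G': "finite (verts G')" "edges G' \<subseteq> nsets (verts G') 2"
    using simple_graph_map_graph[OF G f] by (auto simp: simple_graph_def G'_def)
  have G'H: "verts G' \<subseteq> verts H" "edges G' \<subseteq> edges H" using sub by (auto simp: subgraph_def G'_def)
  have fH: "finite (verts H)" using clique_build_wf[OF build] by simp
  \<comment> \<open>The cliques are those of the whole host, but only edges of \<open>G'\<close> are
    covered, and the cones use no others.\<close>
  from clique_build_hub_cover[OF build k] obtain D S res
    where "hub_cover (edges G') k (verts H) (edges H) A D S res" by blast
  then interpret hub_cover "edges G'" k "verts H" "edges H" A D S res .
  define F where "F w = \<lparr>verts = {u \<in> verts H. w \<in> D u},
    edges = {{u, y} |u y. u \<in> verts H \<and> S u = Some (y, w)}\<rparr>" for w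
  define I where "I w = \<lparr>verts = insert w (verts (F w)),
    edges = edges (F w) \<union> {{w, u} |u. u \<in> verts (F w)}\<rparr>" for w
  have mem: "a \<in> verts G'" "b \<in> verts G'" if "{a, b} \<in> edges G'" for a b
    using that G'(2) by auto
  show ?thesis
  proof (rule local_track_number_le[OF G f G'(1)])
    fix w assume w: "w \<in> verts G'"
    have "w \<notin> verts (F w)" using apex[of w w] by (auto simp: F_def)
    then show "interval_graph (I w)"
      unfolding I_def by (rule interval_graph_cone[rotated])
        (unfold F_def, rule interval_graph_star_forest[OF fH])
    have e: "{u, w} \<in> edges G'" if "u \<in> verts (F w)" for u
      using that apex[of u w] by (simp add: F_def)
    then have "verts (I w) \<subseteq> verts G'" using w mem(1) by (auto simp: I_def)
    moreover have "edges (I w) \<subseteq> edges G'"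
    proof
      fix d assume "d \<in> edges (I w)"
      then consider u y where "d = {u, y}" "u \<in> verts H" "S u = Some (y, w)"
        | u where "d = {w, u}" "u \<in> verts (F w)" by (auto simp: I_def F_def)
      then show "d \<in> edges G'"
      proof cases
        case 1
        then show ?thesis using leaf[OF 1(2,3)] by simp
      next
        case 2
        then show ?thesis using e by (simp add: insert_commute)
      qed
    qed
    ultimately show "subgraph (I w) (map_graph f G)" by (simp add: subgraph_def G'_def)
  next
    have cov: "\<exists>w\<in>verts G'. {a, b} \<in> edges (I w)"
      if ab: "{a, b} \<in> edges G'" "a \<in> D b \<or> (\<exists>w. S a = Some (b, w))" for a b
    proof -
      have abV: "a \<in> verts H" "b \<in> verts H" "a \<in> verts G'" using mem[OF ab(1)] G'H by auto
      from ab(2) show ?thesis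
      proof
        assume "a \<in> D b"
        then have "{a, b} \<in> edges (I a)" using abV by (auto simp: I_def F_def)
        then show ?thesis using abV by blast
      next
        assume "\<exists>w. S a = Some (b, w)"
        then obtain w where w: "S a = Some (b, w)" by blast
        then have "w \<in> D a" using leaf[OF abV(1) w] by simp
        then have "w \<in> verts G'" using apex[OF abV(1)] mem(2)[of a w] by simp
        moreover have "{a, b} \<in> edges (I w)" using w abV by (auto simp: I_def F_def)
        ultimately show ?thesis by blast
      qed
    qed
    show "edges (map_graph f G) \<subseteq> (\<Union>w\<in>verts G'. edges (I w))"
    proof
      fix e assume "e \<in> edges (map_graph f G)"
      then have e: "e \<in> edges G'" by (simp add: G'_def)
      then obtain a b where ab: "e = {a, b}" using G'(2) nsets2_E by (metis subsetD)
      have ba: "{b, a} \<in> edges G'" "{a, b} \<in> edges G'" using e ab by (simp_all add: insert_commute)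
      have "{a, b} \<in> edges H" using ba(2) G'H(2) by blast
      from covered[OF this ba(2)] have "\<exists>w\<in>verts G'. {a, b} \<in> edges (I w) \<or> {b, a} \<in> edges (I w)"
        using cov[OF ba(1)] cov[OF ba(2)] by blast
      moreover have "{b, a} = {a, b}" by (rule insert_commute)
      ultimately show "e \<in> (\<Union>w\<in>verts G'. edges (I w))" unfolding ab by simp
    qed
  next
    fix v assume "v \<in> f ` verts G"
    then have v: "v \<in> verts H" using G'H(1) by (auto simp: G'_def map_graph_def)
    have "D v \<subseteq> verts H" using apex[OF v] by blast
    then have fD: "finite (D v)" using fH finite_subset by blast
    \<comment> \<open>The extra track is the cone with apex \<open>v\<close>; the strict inequality
      in \<open>slack\<close> leaves room for it.\<close>
    have "{w \<in> verts G'. v \<in> verts (I w)} \<subseteq> insert v (D v)" by (auto simp: I_def F_def)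
    from card_mono[OF _ this] have "card {w \<in> verts G'. v \<in> verts (I w)} \<le> Suc (card (D v))"
      using fD by (simp add: card_insert_if split: if_splits)
    then show "card {w \<in> verts G'. v \<in> verts (I w)} \<le> k" using slack[OF v] by linarith
  qed
qed

subsection \<open>Width at most two\<close>

text \<open>
  A simple \<open>2\<close>-tree is cut into paths (spines): \<open>sp u\<close> names the spine of \<open>u\<close> and \<open>pos u\<close> its
  position there.  Every other edge joins a vertex \<open>u\<close> to its set \<open>N u\<close> of at most two consecutive
  vertices of one other spine, on which \<open>u\<close> hangs as a leaf.  An available edge \<open>a\<close> with \<open>d a = 0\<close>
  is a spine edge without a leaf over both ends; otherwise it joins the leaf \<open>bot a\<close> to a vertex of
  \<open>N (bot a)\<close>, and \<open>bot a\<close> is the last vertex of its own spine in direction \<open>d a\<close>.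
\<close>

locale spine_cover =
  fixes V :: "nat set" and H :: "nat set set" and A :: "(nat set \<times> bool) set"
    and sp :: "nat \<Rightarrow> nat" and pos :: "nat \<Rightarrow> int" and N :: "nat \<Rightarrow> nat set"
    and bot :: "nat set \<times> bool \<Rightarrow> nat" and d :: "nat set \<times> bool \<Rightarrow> int"
  assumes sp: "\<And>u. u \<in> V \<Longrightarrow> sp u \<in> V"
    and pos: "\<And>u u'. u \<in> V \<Longrightarrow> u' \<in> V \<Longrightarrow> sp u = sp u' \<Longrightarrow> pos u = pos u' \<Longrightarrow> u = u'"
    and hang: "\<And>u. u \<in> V \<Longrightarrow> N u = {} \<or> (\<exists>a\<in>V. sp a \<noteq> sp u \<and>
      (N u = {a} \<or> (\<exists>b\<in>V. sp b = sp a \<and> pos b = pos a + 1 \<and> N u = {a, b})))"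
    and junction: "\<And>u u' a b. u \<in> V \<Longrightarrow> u' \<in> V \<Longrightarrow> N u = {a, b} \<Longrightarrow> N u' = {a, b} \<Longrightarrow> a \<noteq> b \<Longrightarrow> u = u'"
    and edge: "\<And>a b. {a, b} \<in> H \<Longrightarrow> a \<in> N b \<or> b \<in> N a \<or> (sp a = sp b \<and> \<bar>pos a - pos b\<bar> = 1)"
    and spine_edge: "\<And>C t. (C, t) \<in> A \<Longrightarrow> d (C, t) = 0 \<Longrightarrow>
      \<exists>a\<in>V. \<exists>b\<in>V. C = {a, b} \<and> sp a = sp b \<and> pos b = pos a + 1 \<and> (\<forall>u\<in>V. N u \<noteq> C)"
    and leaf_edge: "\<And>C t. (C, t) \<in> A \<Longrightarrow> d (C, t) \<noteq> 0 \<Longrightarrow>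
      \<bar>d (C, t)\<bar> = 1 \<and> bot (C, t) \<in> V \<and> (\<exists>x\<in>N (bot (C, t)). C = {x, bot (C, t)}) \<and>
      (\<forall>u\<in>V. sp u = sp (bot (C, t)) \<longrightarrow> d (C, t) * pos u \<le> d (C, t) * pos (bot (C, t)))"
    and spine_edge_unique: "\<And>C t t'. (C, t) \<in> A \<Longrightarrow> (C, t') \<in> A \<Longrightarrow> d (C, t) = 0 \<Longrightarrow> d (C, t') = 0 \<Longrightarrow> t = t'"
    and leaf_edge_unique: "\<And>a a'. a \<in> A \<Longrightarrow> a' \<in> A \<Longrightarrow> d a \<noteq> 0 \<Longrightarrow> d a = d a' \<Longrightarrow>
      sp (bot a) = sp (bot a') \<Longrightarrow> a = a'"
begin

lemma N_props:
  assumes "u \<in> V" "x \<in> N u"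
  shows "x \<in> V" "sp x \<noteq> sp u" "\<And>y. y \<in> N u \<Longrightarrow> sp y = sp x"
proof -
  obtain a where a: "a \<in> V" "sp a \<noteq> sp u"
    "N u = {a} \<or> (\<exists>b\<in>V. sp b = sp a \<and> pos b = pos a + 1 \<and> N u = {a, b})"
    using hang[OF assms(1)] assms(2) by auto
  have "x \<in> V \<and> sp x = sp a" if "x \<in> N u" for x using a that by auto
  then show "x \<in> V" "sp x \<noteq> sp u" "\<And>y. y \<in> N u \<Longrightarrow> sp y = sp x" using a(2) assms(2) by simp_all
qed

text \<open>The choices for the new vertex are its spine \<open>s\<close> (a new one if
  \<open>s = v\<close>), its position \<open>p\<close>, the set \<open>M\<close> it hangs on, and a
  direction \<open>\<delta> c\<close> for the new available edge omitting \<open>c\<close>.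
  \<open>o1\<close> and \<open>o2\<close> keep the remaining available edges valid;
  \<open>n0\<close> to \<open>n3\<close> validate the two new ones.\<close>

lemma extend:
  assumes build: "clique_build 2 V H A" and C: "(C, t) \<in> A" and v: "v \<notin> V"
    and s: "s = v \<or> s \<in> V" and p: "\<And>u. u \<in> V \<Longrightarrow> sp u = s \<Longrightarrow> pos u \<noteq> p"
    and M: "\<exists>a\<in>V. sp a \<noteq> s \<and> (M = {a} \<or> (\<exists>b\<in>V. sp b = sp a \<and> pos b = pos a + 1 \<and> M = {a, b}))"
    and M_new: "\<And>u a b. u \<in> V \<Longrightarrow> M = {a, b} \<Longrightarrow> a \<noteq> b \<Longrightarrow> N u \<noteq> M"
    and e: "\<And>c. c \<in> C \<Longrightarrow> c \<in> M \<or> (sp c = s \<and> \<bar>pos c - p\<bar> = 1)"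
    and o1: "\<And>K r. (K, r) \<in> A - {(C, t)} \<Longrightarrow> d (K, r) = 0 \<Longrightarrow> M \<noteq> K"
    and o2: "\<And>a. a \<in> A - {(C, t)} \<Longrightarrow> d a \<noteq> 0 \<Longrightarrow> sp (bot a) = s \<Longrightarrow> d a * p \<le> d a * pos (bot a)"
    and n0: "\<And>c. c \<in> C \<Longrightarrow> \<delta> c = 0 \<Longrightarrow> \<exists>a\<in>V. C - {c} = {a} \<and> sp a = s \<and> \<bar>pos a - p\<bar> = 1"
    and n1: "\<And>c. c \<in> C \<Longrightarrow> \<delta> c \<noteq> 0 \<Longrightarrow> \<bar>\<delta> c\<bar> = 1 \<and> (\<exists>x\<in>M. C - {c} = {x}) \<and>
      (\<forall>u\<in>V. sp u = s \<longrightarrow> \<delta> c * pos u \<le> \<delta> c * p)"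
    and n2: "\<And>c c'. c \<in> C \<Longrightarrow> c' \<in> C \<Longrightarrow> \<delta> c \<noteq> 0 \<Longrightarrow> \<delta> c = \<delta> c' \<Longrightarrow> c = c'"
    and n3: "\<And>a c. a \<in> A - {(C, t)} \<Longrightarrow> c \<in> C \<Longrightarrow> \<delta> c \<noteq> 0 \<Longrightarrow> sp (bot a) = s \<Longrightarrow> d a \<noteq> \<delta> c"
  shows "\<exists>sp' pos' N' bot' d'. spine_cover (insert v V) (H \<union> {{v, c} |c. c \<in> C})
      (A - {(C, t)} \<union> (\<lambda>c. (insert v (C - {c}), False)) ` C) sp' pos' N' bot' d'"
proof -
  note wf = clique_build_wf[OF build]
  have CV: "C \<subseteq> V" using wf(4)[OF C] by auto
  have vC: "v \<notin> C" using CV v by blast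
  define sp' where "sp' = sp(v := s)"
  define pos' where "pos' = pos(v := p)"
  define N' where "N' = N(v := M)"
  define bot' where "bot' a = (if v \<in> fst a then v else bot a)" for a
  define d' where "d' a = (if v \<in> fst a then \<delta> (the_elem (C - fst a)) else d a)" for a
  define f where "f c = (insert v (C - {c}), False)" for c
  define A' where "A' = A - {(C, t)} \<union> f ` C"
  have old: "d' a = d a" "bot' a = bot a" if "a \<in> A" for a
  proof -
    have "v \<notin> fst a" using wf(4)[of "fst a" "snd a"] that v by auto
    then show "d' a = d a" "bot' a = bot a" by (simp_all add: d'_def bot'_def)
  qed
  have oldv: "v \<notin> K" if "(K, r) \<in> A" for K r using wf(4)[OF that] v by blast
  have new: "d' (f c) = \<delta> c" "bot' (f c) = v" if "c \<in> C" for c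
  proof -
    have "C - insert v (C - {c}) = {c}" using that vC by blast
    then show "d' (f c) = \<delta> c" "bot' (f c) = v" by (simp_all add: d'_def bot'_def f_def)
  qed
  have upd: "sp' u = sp u" "pos' u = pos u" "N' u = N u" if "u \<in> V" for u
    using that v by (auto simp: sp'_def pos'_def N'_def)
  have updv: "sp' v = s" "pos' v = p" "N' v = M" by (simp_all add: sp'_def pos'_def N'_def)
  have MV: "M \<subseteq> V" using M by auto
  have NV: "N u \<subseteq> V" if "u \<in> V" for u using N_props(1)[OF that] by blast
  have A'E: thesis if a: "a \<in> A'" and 1: "a \<in> A - {(C, t)} \<Longrightarrow> thesis"
    and 2: "\<And>c. c \<in> C \<Longrightarrow> a = f c \<Longrightarrow> thesis" for a thesis
    using a 1 2 unfolding A'_def by blast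
  have "spine_cover (insert v V) (H \<union> {{v, c} |c. c \<in> C}) A' sp' pos' N' bot' d'"
  proof (rule spine_cover.intro)
    fix u assume "u \<in> insert v V"
    then show "sp' u \<in> insert v V" using sp s by (auto simp: sp'_def)
  next
    fix u u' assume u: "u \<in> insert v V" "u' \<in> insert v V" "sp' u = sp' u'" "pos' u = pos' u'"
    consider "u = v" "u' = v" | "u = v" "u' \<in> V" | "u \<in> V" "u' = v" | "u \<in> V" "u' \<in> V"
      using u(1,2) by blast
    then show "u = u'"
    proof cases
      case 1 then show ?thesis by simp
    next
      case 2 then show ?thesis using p[OF 2(2)] u(3,4) updv upd[OF 2(2)] by simp
    next
      case 3 then show ?thesis using p[OF 3(1)] u(3,4) updv upd[OF 3(1)] by simp
    next
      case 4 then show ?thesis using pos[OF 4] u(3,4) upd[OF 4(1)] upd[OF 4(2)] by simp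
    qed
  next
    fix u assume u: "u \<in> insert v V"
    show "N' u = {} \<or> (\<exists>a\<in>insert v V. sp' a \<noteq> sp' u \<and> (N' u = {a} \<or>
      (\<exists>b\<in>insert v V. sp' b = sp' a \<and> pos' b = pos' a + 1 \<and> N' u = {a, b})))"
    proof (cases "N' u = {}")
      case False
      have "\<exists>a\<in>V. sp a \<noteq> sp' u \<and> (N' u = {a} \<or> (\<exists>b\<in>V. sp b = sp a \<and> pos b = pos a + 1 \<and> N' u = {a, b}))"
      proof (cases "u = v")
        case True
        then show ?thesis using M updv by simp
      next
        case uv: False
        then have "u \<in> V" using u by simp
        then show ?thesis using hang[of u] upd False by simp
      qed
      then obtain a where a: "a \<in> V" "sp a \<noteq> sp' u"
        "N' u = {a} \<or> (\<exists>b\<in>V. sp b = sp a \<and> pos b = pos a + 1 \<and> N' u = {a, b})" by blast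
      from a(3) have "N' u = {a} \<or> (\<exists>b\<in>insert v V. sp' b = sp' a \<and> pos' b = pos' a + 1 \<and> N' u = {a, b})"
        using upd[OF a(1)] upd by auto
      then show ?thesis using a upd[OF a(1)] by (intro disjI2 bexI[of _ a]) auto
    qed simp
  next
    fix u u' a b assume u: "u \<in> insert v V" "u' \<in> insert v V" "N' u = {a, b}" "N' u' = {a, b}" "a \<noteq> b"
    consider "u = v" "u' = v" | "u = v" "u' \<in> V" | "u \<in> V" "u' = v" | "u \<in> V" "u' \<in> V"
      using u(1,2) by blast
    then show "u = u'"
    proof cases
      case 1 then show ?thesis by simp
    next
      case 2 then show ?thesis using M_new[of u' a b] u(3-5) updv upd[OF 2(2)] by simp
    next
      case 3 then show ?thesis using M_new[of u a b] u(3-5) updv upd[OF 3(1)] by simp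
    next
      case 4 then show ?thesis using junction[OF 4 _ _ u(5)] u(3,4) upd[OF 4(1)] upd[OF 4(2)] by simp
    qed
  next
    fix a b assume ab: "{a, b} \<in> H \<union> {{v, c} |c. c \<in> C}"
    show "a \<in> N' b \<or> b \<in> N' a \<or> (sp' a = sp' b \<and> \<bar>pos' a - pos' b\<bar> = 1)"
    proof (cases "{a, b} \<in> H")
      case True
      then have V: "a \<in> V" "b \<in> V" using wf(3) by auto
      show ?thesis using edge[OF True] upd[OF V(1)] upd[OF V(2)] by simp
    next
      case False
      have *: "c \<in> N' v \<or> (sp' c = sp' v \<and> \<bar>pos' c - pos' v\<bar> = 1)" if c: "c \<in> C" for c
      proof -
        have "c \<in> V" using c CV by blast
        then show ?thesis using e[OF c] updv upd by simp
      qed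
      from False ab obtain c where "c \<in> C" "{a, b} = {v, c}" by auto
      then consider "a = v" "b \<in> C" | "b = v" "a \<in> C" by (auto simp: doubleton_eq_iff)
      then show ?thesis
      proof cases
        case 1 then show ?thesis using *[OF 1(2)] by (auto simp: abs_minus_commute)
      next
        case 2 then show ?thesis using *[OF 2(2)] by auto
      qed
    qed
  next
    fix K r assume K: "(K, r) \<in> A'" and dK: "d' (K, r) = 0"
    show "\<exists>a\<in>insert v V. \<exists>b\<in>insert v V. K = {a, b} \<and> sp' a = sp' b \<and> pos' b = pos' a + 1 \<and>
      (\<forall>u\<in>insert v V. N' u \<noteq> K)"
    proof (rule A'E[OF K])
      assume K': "(K, r) \<in> A - {(C, t)}"
      then have KA: "(K, r) \<in> A" by simp
      have dd: "d (K, r) = 0" using dK old(1)[OF KA] by simp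
      from spine_edge[OF KA dd] obtain a b where ab: "a \<in> V" "b \<in> V"
        "K = {a, b}" "sp a = sp b" "pos b = pos a + 1" "\<forall>u\<in>V. N u \<noteq> K" by blast
      have "\<forall>u\<in>insert v V. N' u \<noteq> K" using ab(6) upd(3) updv(3) o1[OF K' dd] by simp
      then show ?thesis using ab upd[OF ab(1)] upd[OF ab(2)]
        by (intro bexI[of _ a] bexI[of _ b]) simp_all
    next
      fix c assume c: "c \<in> C" "(K, r) = f c"
      have "\<delta> c = 0" using new(1)[OF c(1)] c(2) dK by simp
      from n0[OF c(1) this] obtain a where a: "a \<in> V" "C - {c} = {a}" "sp a = s" "\<bar>pos a - p\<bar> = 1" by blast
      have K: "K = {v, a}" using c(2) a(2) by (simp add: f_def)
      \<comment> \<open>Nothing hangs on both ends of the new spine edge yet, since no hanging set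
        contains \<open>v\<close>.\<close>
      have "N' u \<subseteq> V" if "u \<in> insert v V" for u using that upd(3)[of u] updv(3) MV NV[of u] by auto
      moreover have "\<not> K \<subseteq> V" using K v by simp
      ultimately have N: "\<forall>u\<in>insert v V. N' u \<noteq> K" by metis
      consider "p = pos a + 1" | "pos a = p + 1" using a(4) by linarith
      then show ?thesis
      proof cases
        case 1
        then show ?thesis using N K a upd[OF a(1)] updv
          by (intro bexI[of _ a] bexI[of _ v]) auto
      next
        case 2
        then show ?thesis using N K a upd[OF a(1)] updv
          by (intro bexI[of _ v] bexI[of _ a]) auto
      qed
    qed
  next
    fix K r assume K: "(K, r) \<in> A'" and dK: "d' (K, r) \<noteq> 0"
    show "\<bar>d' (K, r)\<bar> = 1 \<and> bot' (K, r) \<in> insert v V \<and> (\<exists>x\<in>N' (bot' (K, r)). K = {x, bot' (K, r)}) \<and>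
      (\<forall>u\<in>insert v V. sp' u = sp' (bot' (K, r)) \<longrightarrow> d' (K, r) * pos' u \<le> d' (K, r) * pos' (bot' (K, r)))"
    proof (rule A'E[OF K])
      assume K': "(K, r) \<in> A - {(C, t)}"
      then have KA: "(K, r) \<in> A" by simp
      note o = old[OF KA]
      have dd: "d (K, r) \<noteq> 0" using dK o by simp
      note le = leaf_edge[OF KA dd]
      then have botV: "bot (K, r) \<in> V" by blast
      show ?thesis using le o2[OF K' dd] upd[OF botV] upd updv unfolding o by auto
    next
      fix c assume c: "c \<in> C" "(K, r) = f c"
      have "\<delta> c \<noteq> 0" using new(1)[OF c(1)] c(2) dK by simp
      note n = n1[OF c(1) this]
      then obtain x where x: "x \<in> M" "C - {c} = {x}" by blast
      have "K = {x, v}" using c(2) x(2) by (auto simp: f_def)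
      then show ?thesis unfolding c(2) new[OF c(1)] using n x(1) updv upd by auto
    qed
  next
    fix K r r' assume K: "(K, r) \<in> A'" "(K, r') \<in> A'" and dK: "d' (K, r) = 0" "d' (K, r') = 0"
    show "r = r'"
    proof (cases "v \<in> K")
      case True
      then have "\<not> r" "\<not> r'" using K oldv by (auto simp: A'_def f_def)
      then show ?thesis by simp
    next
      case False
      then have KA: "(K, r) \<in> A" "(K, r') \<in> A" using K by (auto simp: A'_def f_def)
      then show ?thesis using spine_edge_unique[OF KA] old(1) dK by simp
    qed
  next
    fix a a' assume a: "a \<in> A'" "a' \<in> A'" "d' a \<noteq> 0" "d' a = d' a'" "sp' (bot' a) = sp' (bot' a')"
    have mixed: False if o: "b \<in> A - {(C, t)}" and c: "c \<in> C" "d' b \<noteq> 0" "d' b = d' (f c)"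
      "sp' (bot' b) = sp' (bot' (f c))" for b c
    proof -
      have bA: "b \<in> A" using o by simp
      have "bot b \<in> V" using leaf_edge[of "fst b" "snd b"] bA c(2) old(1)[OF bA] by simp
      then have "sp (bot b) = s" using c(4) new[OF c(1)] old[OF bA] upd updv by simp
      then show False using n3[OF o c(1)] c(2,3) new[OF c(1)] old[OF bA] by simp
    qed
    show "a = a'"
    proof (rule A'E[OF a(1)])
      assume o: "a \<in> A - {(C, t)}"
      show ?thesis
      proof (rule A'E[OF a(2)])
        assume o': "a' \<in> A - {(C, t)}"
        have AA: "a \<in> A" "a' \<in> A" using o o' by auto
        have dd: "d a \<noteq> 0" "d a = d a'" using a(3,4) old[OF AA(1)] old[OF AA(2)] by simp_all
        have "bot a \<in> V" "bot a' \<in> V"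
          using leaf_edge[of "fst a" "snd a"] leaf_edge[of "fst a'" "snd a'"] AA dd by simp_all
        then have "sp (bot a) = sp (bot a')" using a(5) old[OF AA(1)] old[OF AA(2)] upd by simp
        from leaf_edge_unique[OF AA dd this] show ?thesis .
      next
        fix c assume c: "c \<in> C" "a' = f c"
        from mixed[OF o c(1) a(3) a(4,5)[unfolded c(2)]] show ?thesis ..
      qed
    next
      fix c assume c: "c \<in> C" "a = f c"
      show ?thesis
      proof (rule A'E[OF a(2)])
        assume o': "a' \<in> A - {(C, t)}"
        have "d' a' \<noteq> 0" "d' a' = d' (f c)" "sp' (bot' a') = sp' (bot' (f c))"
          using a(3-5) c(2) by metis+
        from mixed[OF o' c(1) this] show ?thesis ..
      next
        fix c' assume c': "c' \<in> C" "a' = f c'"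
        have "c = c'" using n2[OF c(1) c'(1)] a(3,4) new[OF c(1)] new[OF c'(1)] c(2) c'(2) by simp
        then show ?thesis using c c' by simp
      qed
    qed
  qed
  then show ?thesis unfolding A'_def f_def by (intro exI)
qed

text \<open>Single use of edges has two effects: a spine edge receives at most one leaf over both
  its ends, as the interval model requires, and each spine has at most one available leaf edge per
  direction, so each of its ends can be prolonged without conflict.\<close>

lemma step:
  assumes build: "clique_build 2 V H A" and C: "(C, t) \<in> A" and v: "v \<notin> V"
  shows "\<exists>sp' pos' N' bot' d'. spine_cover (insert v V) (H \<union> {{v, c} |c. c \<in> C})
      (A - {(C, t)} \<union> (\<lambda>c. (insert v (C - {c}), False)) ` C) sp' pos' N' bot' d'"
proof (cases "d (C, t) = 0")
  case True
  from spine_edge[OF C True] obtain a b where ab: "a \<in> V" "b \<in> V" "C = {a, b}" "sp a = sp b"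
    "pos b = pos a + 1" and nN: "\<forall>u\<in>V. N u \<noteq> C" by blast
  have neq: "a \<noteq> b" using ab(5) by auto
  have spv: "sp u \<noteq> v" if "u \<in> V" for u using sp[OF that] v by blast
  have botv: "sp (bot x) \<noteq> v" if "x \<in> A" "d x \<noteq> 0" for x
    using leaf_edge[of "fst x" "snd x"] that spv by simp
  \<comment> \<open>For a spine edge, \<open>v\<close> founds a spine of its own and hangs on both
    ends of the edge. Being first and last on that spine, \<open>v\<close> can give the two new
    edges opposite directions.\<close>
  show ?thesis
  proof (rule extend[OF build C v, where s = v and p = 0 and M = C and \<delta> = "\<lambda>c. if c = a then 1 else -1"])
    show "\<exists>a\<in>V. sp a \<noteq> v \<and> (C = {a} \<or> (\<exists>b\<in>V. sp b = sp a \<and> pos b = pos a + 1 \<and> C = {a, b}))"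
      using ab spv[OF ab(1)] by (intro bexI[of _ a] conjI disjI2 bexI[of _ b]) auto
  next
    fix K r assume K: "(K, r) \<in> A - {(C, t)}" "d (K, r) = 0"
    then show "C \<noteq> K" using spine_edge_unique[of C t r] C True by auto
  next
    fix c assume c: "c \<in> C"
    have "\<exists>x\<in>C. C - {c} = {x}" using c ab(3) neq by auto
    then show "\<bar>if c = a then 1 else - 1 :: int\<bar> = 1 \<and> (\<exists>x\<in>C. C - {c} = {x}) \<and>
      (\<forall>u\<in>V. sp u = v \<longrightarrow> (if c = a then 1 else - 1) * pos u \<le> (if c = a then 1 else - 1) * 0)"
      using spv by simp
  next
    fix c c' assume "c \<in> C" "c' \<in> C" "(if c = a then 1 else - 1 :: int) = (if c' = a then 1 else - 1)"
    then show "c = c'" using ab(3) by (auto split: if_splits)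
  next
    fix x c assume x: "x \<in> A - {(C, t)}" "sp (bot x) = v"
    then have "d x = 0" using botv[of x] by auto
    then show "d x \<noteq> (if c = a then 1 else - 1)" by simp
  next
    fix x assume x: "x \<in> A - {(C, t)}" "d x \<noteq> 0" "sp (bot x) = v"
    then show "d x * 0 \<le> d x * pos (bot x)" using botv[of x] by auto
  qed (use nN spv in \<open>auto split: if_splits\<close>)
next
  case False
  define y where "y = bot (C, t)"
  define \<epsilon> where "\<epsilon> = d (C, t)"
  from leaf_edge[OF C False] obtain x where y: "y \<in> V" "x \<in> N y" "C = {x, y}"
    and \<epsilon>: "\<bar>\<epsilon>\<bar> = 1" and last: "\<And>u. u \<in> V \<Longrightarrow> sp u = sp y \<Longrightarrow> \<epsilon> * pos u \<le> \<epsilon> * pos y"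
    unfolding y_def \<epsilon>_def by blast
  have x: "x \<in> V" "sp x \<noteq> sp y" using N_props[OF y(1,2)] by auto
  then have neq: "x \<noteq> y" by blast
  have sq: "\<epsilon> * (pos y + \<epsilon>) = \<epsilon> * pos y + 1" using \<epsilon> by (auto simp: abs_if algebra_simps split: if_splits)
  have other: "d a \<noteq> \<epsilon>" if a: "a \<in> A - {(C, t)}" "sp (bot a) = sp y" for a
  proof
    assume "d a = \<epsilon>"
    then have da: "d a \<noteq> 0" "d a = d (C, t)" using False by (simp_all add: \<epsilon>_def)
    have "a \<in> A" using a(1) by simp
    from leaf_edge_unique[OF this C da] have "a = (C, t)" using a(2) by (simp add: y_def)
    then show False using a by simp
  qed
  \<comment> \<open>For a leaf edge, \<open>v\<close> prolongs the spine of \<open>y\<close> past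
    its end and hangs on \<open>x\<close> alone. The edge to \<open>y\<close> becomes an available
    spine edge; the edge to \<open>x\<close> takes over the direction \<open>\<epsilon>\<close>,
    with \<open>v\<close> as the new end.\<close>
  show ?thesis
  proof (rule extend[OF build C v, where s = "sp y" and p = "pos y + \<epsilon>" and M = "{x}"
      and \<delta> = "\<lambda>c. if c = y then \<epsilon> else 0"])
    fix u assume "u \<in> V" "sp u = sp y"
    then show "pos u \<noteq> pos y + \<epsilon>" using last[of u] sq by auto
  next
    fix K r assume K: "(K, r) \<in> A - {(C, t)}" "d (K, r) = 0"
    then obtain a b where "K = {a, b}" "pos b = pos a + 1" using spine_edge[of K r] by blast
    then show "{x} \<noteq> K" by auto
  next
    fix a assume a: "a \<in> A - {(C, t)}" "d a \<noteq> 0" "sp (bot a) = sp y"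
    have le: "\<bar>d a\<bar> = 1" "d a * pos y \<le> d a * pos (bot a)"
      using leaf_edge[of "fst a" "snd a"] a y(1) by auto
    \<comment> \<open>On this spine the direction \<open>\<epsilon>\<close> belongs to
      \<open>(C, t)\<close>, so any other leaf edge concerns the opposite end, which stays where it
      is.\<close>
    have "d a = - \<epsilon>" using le(1) other[OF a(1,3)] \<epsilon> by linarith
    then have "d a * (pos y + \<epsilon>) = d a * pos y - 1" using sq by (simp add: algebra_simps)
    then show "d a * (pos y + \<epsilon>) \<le> d a * pos (bot a)" using le(2) by simp
  next
    fix c assume "c \<in> C" "(if c = y then \<epsilon> else 0) = 0"
    then have "c = x" using y(3) \<epsilon> by (auto split: if_splits)
    then show "\<exists>a\<in>V. C - {c} = {a} \<and> sp a = sp y \<and> \<bar>pos a - (pos y + \<epsilon>)\<bar> = 1"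
      using y neq \<epsilon> by (intro bexI[of _ y]) auto
  next
    fix c assume "c \<in> C" "(if c = y then \<epsilon> else 0) \<noteq> 0"
    then have c: "c = y" by (auto split: if_splits)
    have "\<epsilon> * pos u \<le> \<epsilon> * (pos y + \<epsilon>)" if "u \<in> V" "sp u = sp y" for u
      using last[OF that] sq by linarith
    then show "\<bar>if c = y then \<epsilon> else 0\<bar> = 1 \<and> (\<exists>z\<in>{x}. C - {c} = {z}) \<and>
      (\<forall>u\<in>V. sp u = sp y \<longrightarrow> (if c = y then \<epsilon> else 0) * pos u \<le> (if c = y then \<epsilon> else 0) * (pos y + \<epsilon>))"
      using c y(3) neq \<epsilon> by auto
  next
    fix a c assume "a \<in> A - {(C, t)}" "sp (bot a) = sp y" "(if c = y then \<epsilon> else 0) \<noteq> 0"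
    then show "d a \<noteq> (if c = y then \<epsilon> else 0)" using other by (auto split: if_splits)
  next
    fix c assume "c \<in> C"
    then show "c \<in> {x} \<or> (sp c = sp y \<and> \<bar>pos c - (pos y + \<epsilon>)\<bar> = 1)" using y(3) \<epsilon> by auto
  qed (use sp y x in \<open>auto split: if_splits\<close>)
qed

end

lemma clique_build_spine_cover:
  assumes "clique_build k V H A" and k: "k = 2"
  shows "\<exists>sp pos N bot d. spine_cover V H A sp pos N bot d"
  using assms(1)
proof (induction rule: clique_build.induct)
  case (base B)
  then obtain b1 b2 where B: "B = {b1, b2}" "b1 \<noteq> b2" using k by (auto simp: card_2_iff)
  \<comment> \<open>Two spines of one vertex each, with \<open>b2\<close> hanging on
    \<open>b1\<close>. The two copies of the base edge serve the two directions at
    \<open>b2\<close>.\<close>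
  have "spine_cover B (nsets B 2) {(B, False), (B, True)} (\<lambda>u. u) (\<lambda>_. 0) ((\<lambda>_. {})(b2 := {b1}))
    (\<lambda>_. b2) (\<lambda>a. if snd a then 1 else -1)"
  proof (rule spine_cover.intro)
    fix a b assume "{a, b} \<in> nsets B 2"
    then show "a \<in> ((\<lambda>_. {})(b2 := {b1})) b \<or> b \<in> ((\<lambda>_. {})(b2 := {b1})) a \<or> (a = b \<and> \<bar>0 - 0 :: int\<bar> = 1)"
      using B by auto
  qed (use B in \<open>auto split: if_splits\<close>)
  then show ?case by (intro exI)
next
  case (step V H A C t v)
  then obtain sp pos N bot d where "spine_cover V H A sp pos N bot d" by (elim exE)
  from spine_cover.step[OF this step.hyps[unfolded k]] show ?case .
qed

text \<open>Passing from the host to \<open>G'\<close> may delete spine edges, or one of the two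
  edges from a leaf to its spine. Both are harmless: the caterpillar lemma tolerates missing spine
  edges, and a leaf that loses one neighbour becomes a leaf with one neighbour.\<close>

lemma local_track_number_le_if_clique_build_2:
  fixes H :: "nat graph"
  assumes G: "simple_graph G" and f: "inj_on f (verts G)" and sub: "subgraph (map_graph f G) H"
    and build: "clique_build 2 (verts H) (edges H) A"
  shows "local_track_number G \<le> 2"
proof -
  define G' where "G' = map_graph f G"
  have G': "finite (verts G')" "edges G' \<subseteq> nsets (verts G') 2"
    using simple_graph_map_graph[OF G f] by (auto simp: simple_graph_def G'_def)
  have G'H: "verts G' \<subseteq> verts H" "edges G' \<subseteq> edges H" using sub by (auto simp: subgraph_def G'_def)
  from clique_build_spine_cover[OF build refl] obtain sp pos N bot d
    where "spine_cover (verts H) (edges H) A sp pos N bot d" by (elim exE)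
  then interpret spine_cover "verts H" "edges H" A sp pos N bot d .
  define P where "P s = {u \<in> verts G'. sp u = s}" for s
  define L where "L s = {u \<in> verts G'. \<exists>x\<in>N u. sp x = s \<and> {x, u} \<in> edges G'}" for s
  define I where "I s = \<lparr>verts = P s \<union> L s, edges = {e \<in> edges G'. \<exists>a b. e = {a, b} \<and> sp a = s \<and>
    (sp b = s \<or> a \<in> N b)}\<rparr>" for s
  have mem: "a \<in> verts G'" "b \<in> verts G'" "a \<noteq> b" if "{a, b} \<in> edges G'" for a b
  proof -
    have "{a, b} \<in> nsets (verts G') 2" using that G'(2) by blast
    then show "a \<in> verts G'" "b \<in> verts G'" "a \<noteq> b" by simp_all
  qed
  have VH: "u \<in> verts H" if "u \<in> verts G'" for u using that G'H(1) by blast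
  have PL: "P s \<inter> L s = {}" for s
  proof -
    have False if u: "u \<in> P s" "u \<in> L s" for u
    proof -
      obtain x where x: "u \<in> verts G'" "x \<in> N u" "sp x = s" using u(2) by (auto simp: L_def)
      show False using N_props(2)[OF VH[OF x(1)] x(2)] x(3) u(1) by (simp add: P_def)
    qed
    then show ?thesis by blast
  qed
  have N_edge: "{x. {x, u} \<in> edges (I s)} = {x \<in> N u. {x, u} \<in> edges G'}" if u: "u \<in> L s" for u s
  proof -
    have uV: "u \<in> verts H" using u VH by (auto simp: L_def)
    obtain z where z: "z \<in> N u" "sp z = s" using u by (auto simp: L_def)
    note Nz = N_props[OF uV z(1)]
    show ?thesis
    proof (intro equalityI subsetI)
      fix x assume "x \<in> {x. {x, u} \<in> edges (I s)}"
      then obtain a b where e: "{x, u} \<in> edges G'" "{x, u} = {a, b}" "sp a = s" "sp b = s \<or> a \<in> N b"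
        by (auto simp: I_def)
      have "a \<noteq> u" "b \<noteq> u \<or> sp b \<noteq> s" using e(3) Nz(2) z(2) by auto
      then have ab: "a = x" "b = u" using e(2) by (auto simp: doubleton_eq_iff)
      have "sp u \<noteq> s" using Nz(2) z(2) by simp
      then have "x \<in> N u" using e(4) unfolding ab by blast
      then show "x \<in> {x \<in> N u. {x, u} \<in> edges G'}" using e(1) by blast
    next
      fix x assume x: "x \<in> {x \<in> N u. {x, u} \<in> edges G'}"
      then have "sp x = s" using Nz(3) z(2) by simp
      then show "x \<in> {x. {x, u} \<in> edges (I s)}" using x by (auto simp: I_def)
    qed
  qed
  show ?thesis
  proof (rule local_track_number_le[OF G f, where W = "sp ` verts G' \<union> (\<Union>u\<in>verts G'. sp ` N u)" and I = I])
    have "finite (N u)" if "u \<in> verts G'" for u using hang[OF VH[OF that]] by auto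
    then show "finite (sp ` verts G' \<union> (\<Union>u\<in>verts G'. sp ` N u))" using G'(1) by auto
  next
    fix s
    show "interval_graph (I s)"
    proof (rule interval_graph_caterpillar[where P = "P s" and L = "L s" and pos = pos])
      have "e \<in> nsets (verts (I s)) 2" if "e \<in> edges (I s)" for e
      proof -
        from that obtain a b where e: "e = {a, b}" "e \<in> edges G'" "sp a = s" "sp b = s \<or> a \<in> N b"
          by (auto simp: I_def)
        have ab: "{a, b} \<in> edges G'" using e by simp
        have "a \<in> verts (I s)" using e mem[OF ab] by (simp add: I_def P_def)
        moreover have "b \<in> verts (I s)" using e(3,4) ab mem[OF ab] by (auto simp: I_def P_def L_def)
        ultimately show ?thesis using e(1) mem(3)[OF ab] by simp
      qed
      moreover have "finite (P s \<union> L s)" using G'(1) by (simp add: P_def L_def)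
      ultimately show "simple_graph (I s)" by (auto simp: simple_graph_def I_def)
    next
      show "inj_on pos (P s)"
      proof (rule inj_onI)
        fix u u' assume "u \<in> P s" "u' \<in> P s" "pos u = pos u'"
        then show "u = u'" using pos[of u u'] VH by (simp add: P_def)
      qed
    next
      fix a b assume ab: "a \<in> P s" "b \<in> P s" "{a, b} \<in> edges (I s)"
      then have e: "{a, b} \<in> edges H" "sp a = sp b" "a \<in> verts H" "b \<in> verts H"
        using G'H VH by (auto simp: I_def P_def)
      then show "\<bar>pos a - pos b\<bar> = 1" using edge[OF e(1)] N_props(2)[of a b] N_props(2)[of b a] by auto
    next
      fix u assume u: "u \<in> L s"
      have uV: "u \<in> verts H" using u VH by (auto simp: L_def)
      obtain z where z: "z \<in> N u" "sp z = s" "{z, u} \<in> edges G'" using u by (auto simp: L_def)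
      define M where "M = {x \<in> N u. {x, u} \<in> edges G'}"
      have MP: "M \<subseteq> P s"
      proof
        fix x assume "x \<in> M"
        then show "x \<in> P s" using mem(1)[of x u] N_props(3)[OF uV z(1), of x] z(2) by (simp add: M_def P_def)
      qed
      have MN: "M \<subseteq> N u" and zM: "z \<in> M" using z by (auto simp: M_def)
      have "\<exists>a\<in>P s. M = {a} \<or> (\<exists>b\<in>P s. M = {a, b} \<and> pos b = pos a + 1)"
      proof (cases "M = {z}")
        case True
        then show ?thesis using MP by blast
      next
        case False
        then obtain z' where z': "z' \<in> M" "z' \<noteq> z" using zM by blast
        obtain a where a: "N u = {a} \<or> (\<exists>b. pos b = pos a + 1 \<and> N u = {a, b})"
          using hang[OF uV] z(1) by auto
        have "N u \<noteq> {a}" using z' zM MN by (metis singletonD subsetD)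
        then obtain b where b: "pos b = pos a + 1" "N u = {a, b}" using a by blast
        have "M = {a, b}" using z' zM MN unfolding b(2) by blast
        then show ?thesis using b(1) MP by blast
      qed
      then show "\<exists>a\<in>P s. {x. {x, u} \<in> edges (I s)} = {a} \<or>
        (\<exists>b\<in>P s. {x. {x, u} \<in> edges (I s)} = {a, b} \<and> pos b = pos a + 1)"
        unfolding N_edge[OF u] M_def .
    next
      fix u u' a b assume u: "u \<in> L s" "u' \<in> L s" "{x. {x, u} \<in> edges (I s)} = {a, b}"
        "{x. {x, u'} \<in> edges (I s)} = {a, b}" "a \<noteq> b"
      have uV: "u \<in> verts H" "u' \<in> verts H" using u(1,2) VH by (auto simp: L_def)
      \<comment> \<open>A hanging set has at most two elements, so a leaf that still sees both
        \<open>a\<close> and \<open>b\<close> hangs on exactly these, and \<open>junction\<close>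
        applies.\<close>
      have full: "N w = {a, b}" if w: "w \<in> verts H" "{a, b} \<subseteq> N w" for w
        using hang[OF w(1)] w(2) u(5) by auto
      have "{a, b} \<subseteq> N u" "{a, b} \<subseteq> N u'" using u(3,4) unfolding N_edge[OF u(1)] N_edge[OF u(2)] by auto
      then show "u = u'" using junction[OF uV _ _ u(5)] full uV by blast
    qed (use PL in \<open>auto simp: I_def\<close>)
    show "subgraph (I s) (map_graph f G)"
      by (auto simp: subgraph_def I_def P_def L_def simp flip: G'_def)
  next
    show "edges (map_graph f G) \<subseteq> (\<Union>s\<in>sp ` verts G' \<union> (\<Union>u\<in>verts G'. sp ` N u). edges (I s))"
    proof
      fix e assume "e \<in> edges (map_graph f G)"
      then have e: "e \<in> edges G'" by (simp add: G'_def)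
      then have "e \<in> nsets (verts G') 2" using G'(2) by blast
      then obtain a b where ab: "e = {a, b}" "a \<in> verts G'" "b \<in> verts G'" by (rule nsets2_E)
      then have "{a, b} \<in> edges H" using e G'H(2) by blast
      from edge[OF this] have "e \<in> edges (I (sp a)) \<or> e \<in> edges (I (sp b))"
        using e ab(1) insert_commute[of a b "{}"] by (auto simp: I_def)
      then show "e \<in> (\<Union>s\<in>sp ` verts G' \<union> (\<Union>u\<in>verts G'. sp ` N u). edges (I s))"
        using ab(2,3) by blast
    qed
  next
    fix v assume "v \<in> f ` verts G"
    then have v: "v \<in> verts H" using G'H(1) by (auto simp: G'_def map_graph_def)
    define W where "W = {s \<in> sp ` verts G' \<union> (\<Union>u\<in>verts G'. sp ` N u). v \<in> verts (I s)}"
    have "s \<in> insert (sp v) (sp ` N v)" if "v \<in> verts (I s)" for s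
    proof -
      from that have "sp v = s \<or> (\<exists>x\<in>N v. sp x = s)" by (auto simp: I_def P_def L_def)
      then show ?thesis by blast
    qed
    then have W: "W \<subseteq> insert (sp v) (sp ` N v)" unfolding W_def by blast
    show "card W \<le> 2"
    proof (cases "N v = {}")
      case True
      then show ?thesis using card_mono[OF _ W] by simp
    next
      case False
      then obtain z where "z \<in> N v" by blast
      then have "sp ` N v \<subseteq> {sp z}" using N_props(3)[OF v] by blast
      then have "W \<subseteq> {sp v, sp z}" using W by blast
      then have "card W \<le> card {sp v, sp z}" by (intro card_mono) auto
      also have "\<dots> \<le> 2" by (simp add: card_insert_if)
      finally show ?thesis .
    qed
  qed
qed

section \<open>Width one: paths\<close>

text \<open>An available clique is the end of the path in direction \<open>d\<close>. As
  \<open>d\<close> is injective on \<open>A\<close> with values 1 and -1, each end is available at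
  most once; the two copies of the base vertex are the two ends of a path with one vertex.\<close>

lemma clique_build_path:
  assumes "clique_build k V H A" and k: "k = 1"
  shows "\<exists>(pos :: 'a \<Rightarrow> int) d. inj_on pos V \<and> (\<forall>a b. {a, b} \<in> H \<longrightarrow> \<bar>pos a - pos b\<bar> = 1) \<and>
    inj_on d A \<and> (\<forall>C t. (C, t) \<in> A \<longrightarrow> \<bar>d (C, t)\<bar> = 1 \<and>
      (\<exists>x\<in>V. C = {x} \<and> (\<forall>u\<in>V. d (C, t) * pos u \<le> d (C, t) * pos x)))"
  using assms(1)
proof (induction rule: clique_build.induct)
  case (base B)
  then obtain b where B: "B = {b}" using k by (auto simp: card_1_singleton_iff)
  show ?case
    by (rule exI[of _ "\<lambda>_. 0"], rule exI[of _ "\<lambda>a. if snd a then 1 else -1"])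
      (auto simp: B inj_on_def)
next
  case (step V H A C t v)
  then obtain pos :: "'a \<Rightarrow> int" and d where pos: "inj_on pos V"
    and edge: "\<And>a b. {a, b} \<in> H \<Longrightarrow> \<bar>pos a - pos b\<bar> = 1" and d: "inj_on d A"
    and avail: "\<And>C t. (C, t) \<in> A \<Longrightarrow> \<bar>d (C, t)\<bar> = 1 \<and>
      (\<exists>x\<in>V. C = {x} \<and> (\<forall>u\<in>V. d (C, t) * pos u \<le> d (C, t) * pos x))" by metis
  note wf = clique_build_wf[OF step.hyps(1)]
  define \<epsilon> where "\<epsilon> = d (C, t)"
  from avail[OF step.hyps(2)] obtain x where \<epsilon>: "\<bar>\<epsilon>\<bar> = 1" and x: "x \<in> V" "C = {x}"
    and last: "\<And>u. u \<in> V \<Longrightarrow> \<epsilon> * pos u \<le> \<epsilon> * pos x" unfolding \<epsilon>_def by blast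
  have sq: "\<epsilon> * (pos x + \<epsilon>) = \<epsilon> * pos x + 1" using \<epsilon> by (auto simp: abs_if algebra_simps split: if_splits)
  define pos' where "pos' = pos(v := pos x + \<epsilon>)"
  define d' where "d' = d(({v}, False) := \<epsilon>)"
  have upd: "pos' u = pos u" if "u \<in> V" for u using that step.hyps(3) by (auto simp: pos'_def)
  have v: "pos' v = pos x + \<epsilon>" by (simp add: pos'_def)
  have A': "A - {(C, t)} \<union> (\<lambda>c. (insert v (C - {c}), False)) ` C = insert ({v}, False) (A - {(C, t)})"
    using x(2) by auto
  have old: "d' a = d a" if "a \<in> A" for a
  proof -
    have "fst a \<subseteq> V" using wf(4)[of "fst a" "snd a"] that by simp
    then have "a \<noteq> ({v}, False)" using step.hyps(3) by auto
    then show ?thesis by (simp add: d'_def)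
  qed
  have other: "d a \<noteq> \<epsilon>" if "a \<in> A - {(C, t)}" for a
    using d that step.hyps(2) by (auto simp: inj_on_def \<epsilon>_def)
  have "inj_on pos' (insert v V)"
  proof -
    have "pos u \<noteq> pos x + \<epsilon>" if "u \<in> V" for u using last[OF that] sq by auto
    then have "pos' u \<noteq> pos' v" if "u \<in> V" for u using that upd[OF that] v by simp
    then have "pos' v \<notin> pos' ` V" by force
    moreover have "inj_on pos' V" using pos upd by (simp add: inj_on_def)
    ultimately show ?thesis using step.hyps(3) by simp
  qed
  moreover have "\<bar>pos' a - pos' b\<bar> = 1" if ab: "{a, b} \<in> H \<union> {{v, c} |c. c \<in> C}" for a b
  proof (cases "{a, b} \<in> H")
    case True
    then have "a \<in> V" "b \<in> V" using wf(3) by auto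
    then show ?thesis using edge[OF True] upd by simp
  next
    case False
    then have "{a, b} = {v, x}" using ab x(2) by auto
    then consider "a = v" "b = x" | "a = x" "b = v" by (auto simp: doubleton_eq_iff)
    then show ?thesis using upd[OF x(1)] v \<epsilon> by cases auto
  qed
  moreover have "inj_on d' (insert ({v}, False) (A - {(C, t)}))"
  proof -
    have "inj_on d' (A - {(C, t)})" using d old by (simp add: inj_on_def)
    moreover have "d' ({v}, False) \<notin> d' ` (A - {(C, t)})" using old other by (auto simp: d'_def)
    ultimately show ?thesis by (auto simp: inj_on_insert)
  qed
  moreover have "\<bar>d' (K, r)\<bar> = 1 \<and> (\<exists>y\<in>insert v V. K = {y} \<and>
    (\<forall>u\<in>insert v V. d' (K, r) * pos' u \<le> d' (K, r) * pos' y))"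
    if K: "(K, r) \<in> insert ({v}, False) (A - {(C, t)})" for K r
  proof (cases "(K, r) = ({v}, False)")
    case True
    then have K: "K = {v}" "d' (K, r) = \<epsilon>" by (simp_all add: d'_def)
    have "\<epsilon> * pos' u \<le> \<epsilon> * pos' v" if "u \<in> insert v V" for u
    proof (cases "u = v")
      case False
      then have "u \<in> V" using that by simp
      then show ?thesis using last upd[of u] v sq by fastforce
    qed simp
    then show ?thesis unfolding K(2) using K(1) \<epsilon> by blast
  next
    case False
    then have o: "(K, r) \<in> A - {(C, t)}" using K by blast
    then have KA: "(K, r) \<in> A" by simp
    from avail[OF KA] obtain y where y: "\<bar>d (K, r)\<bar> = 1" "y \<in> V" "K = {y}"
      and le: "\<And>u. u \<in> V \<Longrightarrow> d (K, r) * pos u \<le> d (K, r) * pos y" by blast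
    \<comment> \<open>Any other available clique is the opposite end of the path, which the new
      vertex does not pass.\<close>
    have "d (K, r) = - \<epsilon>" using y(1) other[OF o] \<epsilon> by linarith
    then have "d (K, r) * (pos x + \<epsilon>) = d (K, r) * pos x - 1" using sq by (simp add: algebra_simps)
    then have "d (K, r) * pos' v \<le> d (K, r) * pos' y" using le[OF x(1)] v upd[OF y(2)] by simp
    then have "d (K, r) * pos' u \<le> d (K, r) * pos' y" if "u \<in> insert v V" for u
      using that le[of u] upd[of u] upd[OF y(2)] by auto
    then show ?thesis unfolding old[OF KA] using y by blast
  qed
  ultimately show ?case unfolding A' by (intro exI[of _ pos'] exI[of _ d'] conjI allI impI) simp_all
qed

text \<open>The copy of \<open>G\<close> is a single track: a caterpillar without leaves,
  interrupted where edges of the host are missing.\<close>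

lemma local_track_number_le_if_clique_build_1:
  fixes H :: "nat graph"
  assumes G: "simple_graph G" and f: "inj_on f (verts G)" and sub: "subgraph (map_graph f G) H"
    and build: "clique_build 1 (verts H) (edges H) A"
  shows "local_track_number G \<le> 1"
proof -
  obtain pos :: "nat \<Rightarrow> int" where pos: "inj_on pos (verts H)"
    and edge: "\<And>a b. {a, b} \<in> edges H \<Longrightarrow> \<bar>pos a - pos b\<bar> = 1"
    using clique_build_path[OF build refl] by (elim exE conjE) simp
  have G'H: "verts (map_graph f G) \<subseteq> verts H" "edges (map_graph f G) \<subseteq> edges H"
    using sub by (auto simp: subgraph_def)
  have "interval_graph (map_graph f G)"
  proof (rule interval_graph_caterpillar[where P = "verts (map_graph f G)" and L = "{}" and pos = pos])
    show "simple_graph (map_graph f G)" by (rule simple_graph_map_graph[OF G f])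
    show "inj_on pos (verts (map_graph f G))" using pos G'H(1) by (rule inj_on_subset)
    fix a b assume "{a, b} \<in> edges (map_graph f G)"
    then show "\<bar>pos a - pos b\<bar> = 1" using edge G'H(2) by blast
  qed auto
  then show ?thesis
    by (intro local_track_number_le[OF G f, where W = "{()}" and I = "\<lambda>_. map_graph f G"])
      (auto simp: subgraph_def card_insert_if intro: order_trans[OF card_mono[of "{()}"]])
qed

section \<open>Width zero: no edges and no tracks\<close>

lemma clique_build_edgeless:
  assumes "clique_build k V H A" and k: "k = 0"
  shows "H = {}"
  using assms(1)
proof (induction rule: clique_build.induct)
  case (base B)
  then show ?case using k by (simp add: nsets_eq_empty_iff)
next
  case (step V H A C t v)
  have "C = {}" using clique_build_wf(4)[OF step.hyps(1,2)] k by auto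
  then show ?case using step.IH by simp
qed

lemma local_track_number_le_if_clique_build_0:
  assumes G: "simple_graph G" and f: "inj_on f (verts G)" and sub: "subgraph (map_graph f G) H"
    and build: "clique_build 0 (verts H) (edges H) A"
  shows "local_track_number G \<le> 0"
proof -
  have "edges (map_graph f G) = {}"
    using sub clique_build_edgeless[OF build refl] by (simp add: subgraph_def)
  then show ?thesis
    by (intro local_track_number_le[OF G f, where W = "{} :: unit set"
        and I = "\<lambda>_. map_graph f G"]) auto
qed

section \<open>The four ranges of the width combined\<close>

theorem theorem14:
  fixes G :: "'a graph"
  assumes "simple_graph G"
  shows "local_track_number G \<le> simple_tree_width G"
proof -
  define k where "k = simple_tree_width G"
  have "partial_simple_ktree k G"
    unfolding k_def simple_tree_width_def by (rule LeastI_ex[OF ex_partial_simple_ktree[OF assms]])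
  then obtain H :: "nat graph" and f where H: "simple_ktree k H"
    and f: "inj_on f (verts G)" "subgraph (map_graph f G) H"
    unfolding partial_simple_ktree_def by (elim exE conjE)
  obtain A where A: "clique_build k (verts H) (edges H) A"
    using H by (rule simple_ktree_clique_build)
  consider "k = 0" | "k = 1" | "k = 2" | "3 \<le> k" by linarith
  then have "local_track_number G \<le> k"
  proof cases
    case 1
    then show ?thesis using local_track_number_le_if_clique_build_0[OF assms f] A by simp
  next
    case 2
    then show ?thesis using local_track_number_le_if_clique_build_1[OF assms f] A by simp
  next
    case 3
    then show ?thesis using local_track_number_le_if_clique_build_2[OF assms f] A by simp
  next
    case 4
    then show ?thesis by (rule local_track_number_le_if_clique_build_ge_3[OF assms f A])
  qed
  then show ?thesis by (simp add: k_def)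
qed

end
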